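(* Let $(\Omega,\Sigma,\mu)$ be a $\sigma$-finite measure space, $\mathcal{A}\subseteq\Sigma$ a $\sigma$-subalgebra such that $(\Omega,\mathcal{A},\mu)$ is $\sigma$-finite, $E=E^{\mathcal{A}}$ the conditional expectation, $\Phi$ a Young's function, $u$ a $\Sigma$-measurable function on $\Omega$, and suppose the operator $R_u:L^{\Phi}(\Sigma)\to L^{\Phi}(\Sigma)$, $R_u(f)=E(uf)$, is (well defined and) bounded. Let $\{A_n\}_{n\in\mathbb{N}}$ be the $\mathcal{A}$-atoms and $a_n=\mu(A_n)$. Then: (a) If $(E,\Phi)$ satisfies the GCH-inequality with constant $C$, and $$\beta_2=\inf\{\varepsilon>0:\ \{w\in\Omega:(\Phi^{*})^{-1}(E(\Phi^{*}(u)))(w)\ge\varepsilon\}\text{ consists of finitely many }\mathcal{A}\text{-atoms}\},$$ then $\|R_u\|_e\le C\beta_2$. (b) Suppose $a_n\to0$ or $\{a_n\}_{n\in\mathbb{N}}$ has no convergent subsequence, and let $$\beta_1=\inf\{\varepsilon>0:\ \{w\in\Omega:|E(u)(w)|\ge\varepsilon\}\text{ consists of finitely many }\mathcal{A}\text{-atoms}\}.$$ Then $\|R_u\|_e\ge\beta_1$.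
   Context: A Young's function is a continuous convex even function $\Phi:\mathbb{R}\to\mathbb{R}$ with $\Phi(x)=0$ iff $x=0$, $\lim_{x\to\infty}\Phi(x)=\infty$ and $\lim_{x\to\infty}\Phi(x)/x=\infty$. Its complementary function is $\Phi^{*}(y)=\sup\{x|y|-\Phi(x):x\ge 0\}$; it is taken to have the same properties, so that $\Phi$ and $\Phi^{*}$ are strictly increasing on $[0,\infty)$ with inverses $\Phi^{-1},(\Phi^{*})^{-1}:[0,\infty)\to[0,\infty)$ (with value $\infty$ at $\infty$). For a complex-valued function $f$, $\Phi(f)$ means $\Phi(|f|)$. $L^{\Phi}(\Sigma)$ is the Orlicz space of $\Sigma$-measurable $f:\Omega\to\mathbb{C}$ with $\int_\Omega\Phi(k|f|)\,d\mu<\infty$ for some $k>0$, with norm $N_\Phi(f)=\inf\{k>0:\int_\Omega\Phi(f/k)\,d\mu\le 1\}$. $E(f)=E^{\mathcal{A}}(f)$ is the a.e. unique $\mathcal{A}$-measurable function with $\int_A f\,d\mu=\int_A E(f)\,d\mu$ for $A\in\mathcal{A}$, defined for nonnegative measurable $f$ and extended by linearity to $f$ with $E(|f|)<\infty$ a.e. An $\mathcal{A}$-atom is $A\in\mathcal{A}$ with $\mu(A)>0$ such that each $F\in\mathcal{A}$, $F\subseteq A$, has $\mu(F)=0$ or $\mu(F)=\mu(A)$; atoms and sets are considered up to null sets, and the atoms $A_n$ are pairwise disjoint. "Consists of finitely many atoms" means being, up to a null set, a finite (possibly empty) union of $\mathcal{A}$-atoms. The pair $(E,\Phi)$ satisfies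 the GCH-inequality with constant $C>0$ if for all $f\in L^{\Phi}(\Sigma)$ and $g\in L^{\Phi^{*}}(\Sigma)$, $E(|fg|)\le C\,\Phi^{-1}(E(\Phi(|f|)))\,(\Phi^{*})^{-1}(E(\Phi^{*}(|g|)))$ a.e. For a bounded linear operator $T$ on a Banach space, the essential norm is $\|T\|_e=\inf\{\|T-S\|:S\text{ compact}\}$. *)

theory Defs
  imports "HOL-Probability.Probability"
begin

text \<open>Young's functions, their complementary functions, and the inverse on $[0,\infty]$.\<close>

definition young_function :: "(real \<Rightarrow> real) \<Rightarrow> bool" where
  "young_function \<Phi> \<longleftrightarrow>
     continuous_on UNIV \<Phi> \<and> convex_on UNIV \<Phi> \<and> (\<forall>x. \<Phi> (- x) = \<Phi> x) \<and>
     (\<forall>x. \<Phi> x = 0 \<longleftrightarrow> x = 0) \<and>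
     filterlim \<Phi> at_top at_top \<and> filterlim (\<lambda>x. \<Phi> x / x) at_top at_top"

definition young_conj :: "(real \<Rightarrow> real) \<Rightarrow> real \<Rightarrow> real" where
  "young_conj \<Phi> y = (SUP x\<in>{0..}. x * \<bar>y\<bar> - \<Phi> x)"

definition young_inv :: "(real \<Rightarrow> real) \<Rightarrow> ennreal \<Rightarrow> ennreal" where
  "young_inv \<Phi> t = (if t = \<infinity> then \<infinity> else ennreal (the_inv_into {0..} \<Phi> (enn2real t)))"

text \<open>
  Elements of the Orlicz space are represented by functions; equality in the space is equality
  almost everywhere, so a linear operator on the space is a map on representatives that respects
  almost-everywhere equality and is linear up to it.
  Norms take values in \<^typ>\<open>ennreal\<close>; the Luxemburg norm is finite on the Orlicz space.
\<close>

definition orlicz_space :: "'a measure \<Rightarrow> (real \<Rightarrow> real) \<Rightarrow> ('a \<Rightarrow> complex) set" where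
  "orlicz_space M \<Phi> =
     {f \<in> borel_measurable M. \<exists>k>0. (\<integral>\<^sup>+x. ennreal (\<Phi> (k * cmod (f x))) \<partial>M) < \<infinity>}"

definition orlicz_norm :: "'a measure \<Rightarrow> (real \<Rightarrow> real) \<Rightarrow> ('a \<Rightarrow> complex) \<Rightarrow> ennreal" where
  "orlicz_norm M \<Phi> f =
     (INF k\<in>{k::real. 0 < k \<and> (\<integral>\<^sup>+x. ennreal (\<Phi> (cmod (f x) / k)) \<partial>M) \<le> 1}. ennreal k)"

definition orlicz_linear ::
  "'a measure \<Rightarrow> (real \<Rightarrow> real) \<Rightarrow> (('a \<Rightarrow> complex) \<Rightarrow> 'a \<Rightarrow> complex) \<Rightarrow> bool" where
  "orlicz_linear M \<Phi> T \<longleftrightarrow>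
     (\<forall>f\<in>orlicz_space M \<Phi>. T f \<in> orlicz_space M \<Phi>) \<and>
     (\<forall>f\<in>orlicz_space M \<Phi>. \<forall>g\<in>orlicz_space M \<Phi>.
        (AE x in M. f x = g x) \<longrightarrow> (AE x in M. T f x = T g x)) \<and>
     (\<forall>f\<in>orlicz_space M \<Phi>. \<forall>g\<in>orlicz_space M \<Phi>.
        AE x in M. T (\<lambda>y. f y + g y) x = T f x + T g x) \<and>
     (\<forall>c. \<forall>f\<in>orlicz_space M \<Phi>. AE x in M. T (\<lambda>y. c * f y) x = c * T f x)"

definition orlicz_bounded_linear ::
  "'a measure \<Rightarrow> (real \<Rightarrow> real) \<Rightarrow> (('a \<Rightarrow> complex) \<Rightarrow> 'a \<Rightarrow> complex) \<Rightarrow> bool" where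
  "orlicz_bounded_linear M \<Phi> T \<longleftrightarrow>
     orlicz_linear M \<Phi> T \<and>
     (\<exists>K::real. \<forall>f\<in>orlicz_space M \<Phi>.
        orlicz_norm M \<Phi> (T f) \<le> ennreal K * orlicz_norm M \<Phi> f)"

definition orlicz_compact_op ::
  "'a measure \<Rightarrow> (real \<Rightarrow> real) \<Rightarrow> (('a \<Rightarrow> complex) \<Rightarrow> 'a \<Rightarrow> complex) \<Rightarrow> bool" where
  "orlicz_compact_op M \<Phi> S \<longleftrightarrow>
     orlicz_linear M \<Phi> S \<and>
     (\<forall>f. (\<forall>n::nat. f n \<in> orlicz_space M \<Phi> \<and> orlicz_norm M \<Phi> (f n) \<le> 1) \<longrightarrow>
        (\<exists>r. strict_mono r \<and>
          (\<exists>g\<in>orlicz_space M \<Phi>.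
             (\<lambda>n. orlicz_norm M \<Phi> (\<lambda>x. S (f (r n)) x - g x)) \<longlonglongrightarrow> 0)))"

definition orlicz_opnorm ::
  "'a measure \<Rightarrow> (real \<Rightarrow> real) \<Rightarrow> (('a \<Rightarrow> complex) \<Rightarrow> 'a \<Rightarrow> complex) \<Rightarrow> ennreal" where
  "orlicz_opnorm M \<Phi> T =
     (SUP f\<in>{f \<in> orlicz_space M \<Phi>. orlicz_norm M \<Phi> f \<le> 1}. orlicz_norm M \<Phi> (T f))"

definition orlicz_ess_norm ::
  "'a measure \<Rightarrow> (real \<Rightarrow> real) \<Rightarrow> (('a \<Rightarrow> complex) \<Rightarrow> 'a \<Rightarrow> complex) \<Rightarrow> ennreal" where
  "orlicz_ess_norm M \<Phi> T =
     (INF S\<in>{S. orlicz_compact_op M \<Phi> S}. orlicz_opnorm M \<Phi> (\<lambda>f x. T f x - S f x))"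

text \<open>
  The extension of conditional expectation to complex functions is meaningful where
  \<open>nn_cond_exp M F (\<lambda>x. cmod (f x))\<close> is finite almost everywhere; it is not restricted to
  integrable functions, since \<^const>\<open>real_cond_exp\<close> is the difference of the nonnegative
  conditional expectations of the positive and negative parts.
\<close>

definition complex_cond_exp ::
  "'a measure \<Rightarrow> 'a measure \<Rightarrow> ('a \<Rightarrow> complex) \<Rightarrow> 'a \<Rightarrow> complex" where
  "complex_cond_exp M F f =
     (\<lambda>x. Complex (real_cond_exp M F (\<lambda>y. Re (f y)) x) (real_cond_exp M F (\<lambda>y. Im (f y)) x))"

definition cond_exp_mult ::
  "'a measure \<Rightarrow> 'a measure \<Rightarrow> ('a \<Rightarrow> complex) \<Rightarrow> ('a \<Rightarrow> complex) \<Rightarrow> 'a \<Rightarrow> complex" where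
  "cond_exp_mult M F u f = complex_cond_exp M F (\<lambda>x. u x * f x)"

definition cond_exp_mult_bounded ::
  "'a measure \<Rightarrow> 'a measure \<Rightarrow> (real \<Rightarrow> real) \<Rightarrow> ('a \<Rightarrow> complex) \<Rightarrow> bool" where
  "cond_exp_mult_bounded M F \<Phi> u \<longleftrightarrow>
     (\<forall>f\<in>orlicz_space M \<Phi>. AE x in M. nn_cond_exp M F (\<lambda>y. ennreal (cmod (u y * f y))) x < \<infinity>) \<and>
     orlicz_bounded_linear M \<Phi> (cond_exp_mult M F u)"

definition subalg_atom :: "'a measure \<Rightarrow> 'a measure \<Rightarrow> 'a set \<Rightarrow> bool" where
  "subalg_atom M F A \<longleftrightarrow>
     A \<in> sets F \<and> 0 < emeasure M A \<and>
     (\<forall>B\<in>sets F. B \<subseteq> A \<longrightarrow> emeasure M B = 0 \<or> emeasure M B = emeasure M A)"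

definition finitely_many_atoms :: "'a measure \<Rightarrow> 'a measure \<Rightarrow> 'a set \<Rightarrow> bool" where
  "finitely_many_atoms M F W \<longleftrightarrow>
     (\<exists>\<B>. finite \<B> \<and> (\<forall>B\<in>\<B>. subalg_atom M F B) \<and> (AE x in M. x \<in> W \<longleftrightarrow> x \<in> \<Union>\<B>))"

text \<open>
  The atoms are listed as \<open>A n\<close> for \<open>n \<in> N\<close>, where \<open>N\<close> is all of the natural numbers, or
  a smaller (possibly finite or empty) index set if there are fewer atoms.
\<close>

definition atom_enumeration ::
  "'a measure \<Rightarrow> 'a measure \<Rightarrow> nat set \<Rightarrow> (nat \<Rightarrow> 'a set) \<Rightarrow> bool" where
  "atom_enumeration M F N A \<longleftrightarrow>
     (\<forall>n\<in>N. subalg_atom M F (A n)) \<and> disjoint_family_on A N \<and>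
     (\<forall>B. subalg_atom M F B \<longrightarrow> (\<exists>n\<in>N. AE x in M. x \<in> B \<longleftrightarrow> x \<in> A n))"

definition GCH_inequality ::
  "'a measure \<Rightarrow> 'a measure \<Rightarrow> (real \<Rightarrow> real) \<Rightarrow> real \<Rightarrow> bool" where
  "GCH_inequality M F \<Phi> C \<longleftrightarrow>
     (\<forall>f\<in>orlicz_space M \<Phi>. \<forall>g\<in>orlicz_space M (young_conj \<Phi>). AE x in M.
        nn_cond_exp M F (\<lambda>y. ennreal (cmod (f y * g y))) x
        \<le> ennreal C
           * young_inv \<Phi> (nn_cond_exp M F (\<lambda>y. ennreal (\<Phi> (cmod (f y)))) x)
           * young_inv (young_conj \<Phi>)
               (nn_cond_exp M F (\<lambda>y. ennreal (young_conj \<Phi> (cmod (g y)))) x))"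

text \<open>The two thresholds below are \<open>\<infinity>\<close> when no admissible \<open>\<epsilon>\<close> exists.\<close>

definition beta1 :: "'a measure \<Rightarrow> 'a measure \<Rightarrow> ('a \<Rightarrow> complex) \<Rightarrow> ennreal" where
  "beta1 M F u =
     (INF \<epsilon>\<in>{\<epsilon>::real. 0 < \<epsilon> \<and>
        finitely_many_atoms M F {w \<in> space M. cmod (complex_cond_exp M F u w) \<ge> \<epsilon>}}. ennreal \<epsilon>)"

definition beta2 ::
  "'a measure \<Rightarrow> 'a measure \<Rightarrow> (real \<Rightarrow> real) \<Rightarrow> ('a \<Rightarrow> complex) \<Rightarrow> ennreal" where
  "beta2 M F \<Phi> u =
     (INF \<epsilon>\<in>{\<epsilon>::real. 0 < \<epsilon> \<and>
        finitely_many_atoms M F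
          {w \<in> space M. young_inv (young_conj \<Phi>)
             (nn_cond_exp M F (\<lambda>x. ennreal (young_conj \<Phi> (cmod (u x)))) w) \<ge> ennreal \<epsilon>}}.
        ennreal \<epsilon>)"

end

theory Submission
  imports Defs
begin

text \<open>
  (a) If the superlevel set at \<open>\<epsilon>\<close> is a finite union \<open>B\<close> of atoms, then \<open>f \<mapsto> 1\<^sub>B E(uf)\<close> has finite rank,
  since \<open>\<A>\<close>-measurable functions are constant on atoms; off \<open>B\<close>, the GCH-inequality gives
  \<open>\<bar>E(uf)\<bar> \<le> C \<epsilon> \<Phi>\<^sup>-\<^sup>1(E(\<Phi>(f)))\<close>, so the remainder has norm at most \<open>C \<epsilon>\<close>.

  (b) If \<open>{\<bar>E(u)\<bar> \<ge> \<epsilon>}\<close> is not a finite union of atoms, it contains infinitely many disjoint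
  \<open>\<A>\<close>-measurable sets of finite positive measure. Let \<open>f\<^sub>n\<close> be their normalized indicators. For
  compact \<open>S\<close>, a subsequence of \<open>S f\<^sub>n\<close> converges, so \<open>S h\<close> is arbitrarily small for suitable
  differences \<open>h = f\<^sub>m - f\<^sub>n\<close>, while \<open>\<parallel>h\<parallel> \<ge> 1\<close> and \<open>\<parallel>E(uh)\<parallel> \<ge> \<epsilon> \<parallel>h\<parallel>\<close>. Working with differences
  replaces weak convergence of \<open>f\<^sub>n\<close> to \<open>0\<close>, which can fail.
\<close>

section \<open>Young's functions\<close>

locale young =
  fixes \<Phi> :: "real \<Rightarrow> real"
  assumes young: "young_function \<Phi>"
begin

lemma
  shows continuous: "continuous_on UNIV \<Phi>"
    and convex: "convex_on UNIV \<Phi>"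
    and even: "\<Phi> (- x) = \<Phi> x"
    and eq_0_iff: "\<Phi> x = 0 \<longleftrightarrow> x = 0"
    and at_top: "filterlim \<Phi> at_top at_top"
  using young by (auto simp: young_function_def)

lemma zero [simp]: "\<Phi> 0 = 0"
  by (simp add: eq_0_iff)

lemma measurable_young [measurable]: "\<Phi> \<in> borel_measurable borel"
  using continuous by (rule borel_measurable_continuous_onI)

lemma convex_comb:
  "0 \<le> s \<Longrightarrow> 0 \<le> t \<Longrightarrow> s + t = 1 \<Longrightarrow> \<Phi> (s * x + t * y) \<le> s * \<Phi> x + t * \<Phi> y"
  using convex by (auto simp: convex_on_def)

lemma nonneg [simp]: "0 \<le> \<Phi> x"
  \<comment> \<open>The point 0 is the midpoint of \<open>x\<close> and \<open>- x\<close>, where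
    \<open>\<Phi>\<close> takes equal values.\<close>
  using convex_comb[of "1/2" "1/2" x "- x"] by (simp add: even)

lemma pos: "x \<noteq> 0 \<Longrightarrow> 0 < \<Phi> x"
  using nonneg[of x] eq_0_iff[of x] by linarith

lemma scale_le: "0 \<le> s \<Longrightarrow> s \<le> 1 \<Longrightarrow> \<Phi> (s * x) \<le> s * \<Phi> x"
  using convex_comb[of s "1 - s" x 0] by simp

text \<open>By convexity and \<open>\<Phi> 0 = 0\<close> the graph lies below its chords from the
  origin; strictness comes from \<open>x / y < 1\<close> and \<open>\<Phi> y > 0\<close>.\<close>

lemma strict_mono: "0 \<le> x \<Longrightarrow> x < y \<Longrightarrow> \<Phi> x < \<Phi> y"
proof -
  assume "0 \<le> x" "x < y"
  then have "\<Phi> x \<le> (x / y) * \<Phi> y"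
    using scale_le[of "x / y" y] by (simp add: field_simps)
  also have "\<dots> < \<Phi> y"
    using \<open>0 \<le> x\<close> \<open>x < y\<close> pos[of y] by (simp add: field_simps)
  finally show ?thesis .
qed

lemma mono: "0 \<le> x \<Longrightarrow> x \<le> y \<Longrightarrow> \<Phi> x \<le> \<Phi> y"
  using strict_mono[of x y] by (cases "x = y") auto

lemma le_iff: "0 \<le> x \<Longrightarrow> 0 \<le> y \<Longrightarrow> \<Phi> x \<le> \<Phi> y \<longleftrightarrow> x \<le> y"
  using strict_mono[of y x] mono[of x y] by (meson linorder_not_le)

text \<open>Growth at infinity and the intermediate value theorem make the inverse of
  \<open>\<Phi>\<close> total on the nonnegative reals.\<close>

lemma surj: assumes "0 \<le> t" obtains x where "0 \<le> x" "\<Phi> x = t"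
proof -
  have "\<forall>\<^sub>F x in at_top. t \<le> \<Phi> x \<and> 0 \<le> x"
    using at_top eventually_ge_at_top[of 0]
    by (auto simp: filterlim_at_top intro: eventually_conj)
  then obtain b where b: "t \<le> \<Phi> b" "0 \<le> b"
    by (metis (no_types, lifting) eventually_at_top_linorder order_refl)
  have "\<exists>x\<ge>0. x \<le> b \<and> \<Phi> x = t"
    by (rule IVT') (use assms b continuous in \<open>auto intro: continuous_on_subset\<close>)
  then show thesis using that by blast
qed

text \<open>At finite arguments the extended inverse is a real number and can be cancelled against
  \<open>\<Phi>\<close>; this lets estimates with \<open>young_inv\<close> be carried out over the
  reals.\<close>

lemma young_inv:
  assumes "t < \<infinity>" shows "\<exists>y\<ge>0. young_inv \<Phi> t = ennreal y \<and> ennreal (\<Phi> y) = t"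
proof -
  obtain y where y: "0 \<le> y" "\<Phi> y = enn2real t"
    using surj[of "enn2real t"] by auto
  have "inj_on \<Phi> {0..}"
    using strict_mono by (intro linorder_inj_onI) (auto dest: order.strict_implies_not_eq)
  then have "the_inv_into {0..} \<Phi> (enn2real t) = y"
    using y by (intro the_inv_into_f_eq) auto
  then show ?thesis
    using y assms by (intro exI[of _ y]) (simp add: young_inv_def)
qed

end

section \<open>The Luxemburg norm\<close>

text \<open>The Luxemburg norm is an infimum, so norm inequalities are checked against every real
  number strictly above the right-hand side. An infinite right-hand side is covered
  trivially.\<close>

lemma ennreal_le_real_boundsI:
  assumes "\<And>k. 0 < k \<Longrightarrow> y < ennreal k \<Longrightarrow> x \<le> ennreal k"
  shows "x \<le> y"
proof (rule ennreal_le_epsilon)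
  fix e :: real assume "y < top" "0 < e"
  then obtain r where r: "y = ennreal r" "0 \<le> r" by (cases y) auto
  with \<open>0 < e\<close> have "x \<le> ennreal (r + e)"
    by (intro assms) (auto simp: ennreal_less_iff)
  then show "x \<le> y + ennreal e" using r \<open>0 < e\<close> by simp
qed

context young
begin

lemma orlicz_space_measurable: "f \<in> orlicz_space M \<Phi> \<Longrightarrow> f \<in> borel_measurable M"
  by (simp add: orlicz_space_def)

lemma orlicz_norm_leI:
  "0 < k \<Longrightarrow> (\<integral>\<^sup>+x. ennreal (\<Phi> (cmod (f x) / k)) \<partial>M) \<le> 1 \<Longrightarrow> orlicz_norm M \<Phi> f \<le> ennreal k"
  unfolding orlicz_norm_def by (rule INF_lower) auto

text \<open>Since \<open>\<Phi>\<close> increases, admissible scales form an upward closed set, so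
  each scale strictly above the infimum is itself admissible.\<close>

lemma orlicz_norm_lessD:
  assumes "orlicz_norm M \<Phi> f < ennreal k"
  shows "(\<integral>\<^sup>+x. ennreal (\<Phi> (cmod (f x) / k)) \<partial>M) \<le> 1"
proof -
  obtain l where l: "0 < l" "(\<integral>\<^sup>+x. ennreal (\<Phi> (cmod (f x) / l)) \<partial>M) \<le> 1" "ennreal l < ennreal k"
    using assms by (auto simp: orlicz_norm_def INF_less_iff)
  then have "l < k" by (simp add: ennreal_less_iff)
  have "(\<integral>\<^sup>+x. ennreal (\<Phi> (cmod (f x) / k)) \<partial>M) \<le> (\<integral>\<^sup>+x. ennreal (\<Phi> (cmod (f x) / l)) \<partial>M)"
    using l \<open>l < k\<close> by (intro nn_integral_mono ennreal_leI mono divide_left_mono) auto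
  then show ?thesis using l by simp
qed

lemma orlicz_norm_mono:
  assumes "AE x in M. cmod (f x) \<le> cmod (g x)"
  shows "orlicz_norm M \<Phi> f \<le> orlicz_norm M \<Phi> g"
proof (rule ennreal_le_real_boundsI)
  fix k :: real assume k: "0 < k" "orlicz_norm M \<Phi> g < ennreal k"
  have "(\<integral>\<^sup>+x. ennreal (\<Phi> (cmod (f x) / k)) \<partial>M) \<le> (\<integral>\<^sup>+x. ennreal (\<Phi> (cmod (g x) / k)) \<partial>M)"
    using assms k by (intro nn_integral_mono_AE)
      (auto elim!: eventually_mono intro!: ennreal_leI mono divide_right_mono)
  also have "\<dots> \<le> 1" by (rule orlicz_norm_lessD) fact
  finally show "orlicz_norm M \<Phi> f \<le> ennreal k" using k by (intro orlicz_norm_leI)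
qed

lemma orlicz_norm_cong:
  assumes "AE x in M. f x = g x"
  shows "orlicz_norm M \<Phi> f = orlicz_norm M \<Phi> g"
  using assms by (intro antisym orlicz_norm_mono) (auto elim: eventually_mono)

text \<open>If \<open>a\<close> and \<open>b\<close> are admissible for \<open>f\<close> and
  \<open>g\<close>, then \<open>a + b\<close> is admissible for the sum: dividing the sum of the
  moduli by \<open>a + b\<close> gives a convex combination of \<open>cmod (f x) / a\<close> and
  \<open>cmod (g x) / b\<close>.\<close>

lemma orlicz_norm_triangle:
  assumes [measurable]: "f \<in> borel_measurable M" "g \<in> borel_measurable M"
  shows "orlicz_norm M \<Phi> (\<lambda>x. f x + g x) \<le> orlicz_norm M \<Phi> f + orlicz_norm M \<Phi> g"
proof (rule ennreal_le_epsilon)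
  fix e :: real
  assume fin: "orlicz_norm M \<Phi> f + orlicz_norm M \<Phi> g < top" and "0 < e"
  obtain r s where r: "orlicz_norm M \<Phi> f = ennreal r" "0 \<le> r" and s: "orlicz_norm M \<Phi> g = ennreal s" "0 \<le> s"
    using fin by (cases "orlicz_norm M \<Phi> f"; cases "orlicz_norm M \<Phi> g") auto
  \<comment> \<open>The slack makes both scales strictly exceed the norms, and keeps them positive
    when a norm vanishes.\<close>
  define a b where "a = r + e / 2" and "b = s + e / 2"
  have ab: "0 < a" "0 < b" "a + b = r + s + e" using \<open>0 < e\<close> r s by (auto simp: a_def b_def)
  have fa: "(\<integral>\<^sup>+x. ennreal (\<Phi> (cmod (f x) / a)) \<partial>M) \<le> 1"
    by (rule orlicz_norm_lessD) (use r \<open>0 < e\<close> in \<open>auto simp: a_def ennreal_less_iff\<close>)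
  have gb: "(\<integral>\<^sup>+x. ennreal (\<Phi> (cmod (g x) / b)) \<partial>M) \<le> 1"
    by (rule orlicz_norm_lessD) (use s \<open>0 < e\<close> in \<open>auto simp: b_def ennreal_less_iff\<close>)
  let ?s = "a / (a + b)" and ?t = "b / (a + b)"
  have st: "0 \<le> ?s" "0 \<le> ?t" "?s + ?t = 1"
    using ab(1,2) by (auto simp flip: add_divide_distrib)
  have pw: "\<Phi> (cmod (f x + g x) / (a + b)) \<le> ?s * \<Phi> (cmod (f x) / a) + ?t * \<Phi> (cmod (g x) / b)" for x
  proof -
    have "\<Phi> (cmod (f x + g x) / (a + b)) \<le> \<Phi> ((cmod (f x) + cmod (g x)) / (a + b))"
      using ab(1,2) by (intro mono divide_right_mono norm_triangle_ineq) auto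
    also have "(cmod (f x) + cmod (g x)) / (a + b) = ?s * (cmod (f x) / a) + ?t * (cmod (g x) / b)"
      using ab(1,2) by (simp add: add_divide_distrib)
    finally show ?thesis using convex_comb[OF st] order_trans by blast
  qed
  have "(\<integral>\<^sup>+x. ennreal (\<Phi> (cmod (f x + g x) / (a + b))) \<partial>M)
      \<le> (\<integral>\<^sup>+x. ennreal ?s * ennreal (\<Phi> (cmod (f x) / a)) + ennreal ?t * ennreal (\<Phi> (cmod (g x) / b)) \<partial>M)"
  proof (intro nn_integral_mono)
    fix x
    have "ennreal (\<Phi> (cmod (f x + g x) / (a + b)))
        \<le> ennreal (?s * \<Phi> (cmod (f x) / a) + ?t * \<Phi> (cmod (g x) / b))"
      by (rule ennreal_leI[OF pw])
    also have "\<dots> = ennreal ?s * ennreal (\<Phi> (cmod (f x) / a)) + ennreal ?t * ennreal (\<Phi> (cmod (g x) / b))"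
      using st by (simp only: ennreal_plus ennreal_mult nonneg mult_nonneg_nonneg)
    finally show "ennreal (\<Phi> (cmod (f x + g x) / (a + b))) \<le> \<dots>" .
  qed
  also have "\<dots> = ennreal ?s * (\<integral>\<^sup>+x. ennreal (\<Phi> (cmod (f x) / a)) \<partial>M)
      + ennreal ?t * (\<integral>\<^sup>+x. ennreal (\<Phi> (cmod (g x) / b)) \<partial>M)"
    by (simp add: nn_integral_add nn_integral_cmult)
  also have "\<dots> \<le> ennreal ?s * 1 + ennreal ?t * 1"
    using fa gb by (intro add_mono mult_left_mono) auto
  also have "\<dots> = 1" using st by (simp del: ennreal_plus flip: ennreal_plus)
  finally have "orlicz_norm M \<Phi> (\<lambda>x. f x + g x) \<le> ennreal (a + b)"
    using ab by (intro orlicz_norm_leI) auto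
  also have "ennreal (a + b) = orlicz_norm M \<Phi> f + orlicz_norm M \<Phi> g + ennreal e"
    using ab r s \<open>0 < e\<close> by simp
  finally show "orlicz_norm M \<Phi> (\<lambda>x. f x + g x) \<le> orlicz_norm M \<Phi> f + orlicz_norm M \<Phi> g + ennreal e" .
qed

lemma orlicz_norm_uminus: "orlicz_norm M \<Phi> (\<lambda>x. - f x) = orlicz_norm M \<Phi> f"
  by (simp add: orlicz_norm_def)

lemma orlicz_norm_diff_commute:
  "orlicz_norm M \<Phi> (\<lambda>x. f x - g x) = orlicz_norm M \<Phi> (\<lambda>x. g x - f x)"
  by (simp add: orlicz_norm_def norm_minus_commute)

lemma orlicz_norm_zero: "orlicz_norm M \<Phi> (\<lambda>x. 0) = 0"
proof -
  have "orlicz_norm M \<Phi> (\<lambda>x. 0) \<le> 0"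
    by (rule ennreal_le_real_boundsI, rule orlicz_norm_leI) auto
  then show ?thesis by simp
qed

lemma orlicz_norm_cmult_le:
  assumes "c \<noteq> 0"
  shows "orlicz_norm M \<Phi> (\<lambda>x. c * f x) \<le> ennreal (cmod c) * orlicz_norm M \<Phi> f"
proof (rule ennreal_le_real_boundsI)
  fix k :: real assume k: "0 < k" "ennreal (cmod c) * orlicz_norm M \<Phi> f < ennreal k"
  then obtain r where r: "orlicz_norm M \<Phi> f = ennreal r" "0 \<le> r"
    using assms by (cases "orlicz_norm M \<Phi> f") (auto simp: ennreal_mult_top)
  with k have "cmod c * r < k" by (simp add: ennreal_less_iff flip: ennreal_mult)
  then have "orlicz_norm M \<Phi> f < ennreal (k / cmod c)"
    using r assms by (simp add: ennreal_less_iff field_simps)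
  from orlicz_norm_lessD[OF this] show "orlicz_norm M \<Phi> (\<lambda>x. c * f x) \<le> ennreal k"
    using k by (intro orlicz_norm_leI) (auto simp: norm_mult mult_ac)
qed

text \<open>The missing inequality is the one-sided bound for \<open>inverse c\<close>, applied to
  \<open>c * f\<close>.\<close>

lemma orlicz_norm_cmult:
  "orlicz_norm M \<Phi> (\<lambda>x. c * f x) = ennreal (cmod c) * orlicz_norm M \<Phi> f"
proof (cases "c = 0")
  case False
  have "ennreal (cmod c) * orlicz_norm M \<Phi> f = ennreal (cmod c) * orlicz_norm M \<Phi> (\<lambda>x. inverse c * (c * f x))"
    using False by (simp add: mult.assoc[symmetric])
  also have "\<dots> \<le> ennreal (cmod c) * (ennreal (cmod (inverse c)) * orlicz_norm M \<Phi> (\<lambda>x. c * f x))"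
    using False by (intro mult_left_mono orlicz_norm_cmult_le) auto
  also have "\<dots> = orlicz_norm M \<Phi> (\<lambda>x. c * f x)"
    using False by (simp add: mult.assoc[symmetric] norm_inverse flip: ennreal_mult)
  finally show ?thesis using orlicz_norm_cmult_le[OF False] by (intro antisym)
qed (simp add: orlicz_norm_zero)

text \<open>The scale 1 may equal the infimum, so its admissibility is obtained as a limit: scales
  decreasing to 1 are admissible, and Fatou's lemma passes the bound on.\<close>

lemma modular_le_1:
  assumes [measurable]: "f \<in> borel_measurable M" and "orlicz_norm M \<Phi> f \<le> 1"
  shows "(\<integral>\<^sup>+x. ennreal (\<Phi> (cmod (f x))) \<partial>M) \<le> 1"
proof -
  define k where "k n = 1 + 1 / real (Suc n)" for n
  have k: "1 < k n" for n by (simp add: k_def)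
  have lim: "(\<lambda>n. ennreal (\<Phi> (cmod (f x) / k n))) \<longlonglongrightarrow> ennreal (\<Phi> (cmod (f x)))" for x
  proof (intro tendsto_ennrealI)
    have "k \<longlonglongrightarrow> 1 + 0" unfolding k_def by (intro tendsto_intros LIMSEQ_Suc lim_1_over_n)
    then have "(\<lambda>n. cmod (f x) / k n) \<longlonglongrightarrow> cmod (f x) / 1" by (intro tendsto_intros) auto
    then show "(\<lambda>n. \<Phi> (cmod (f x) / k n)) \<longlonglongrightarrow> \<Phi> (cmod (f x))"
      using continuous_on_tendsto_compose[OF continuous] by simp
  qed
  have bd: "(\<integral>\<^sup>+x. ennreal (\<Phi> (cmod (f x) / k n)) \<partial>M) \<le> 1" for n
  proof (rule orlicz_norm_lessD)
    have "1 < ennreal (k n)" using k[of n] by (simp flip: ennreal_1 add: ennreal_less_iff)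
    then show "orlicz_norm M \<Phi> f < ennreal (k n)" using assms(2) by (rule order.strict_trans1[rotated])
  qed
  have "(\<integral>\<^sup>+x. ennreal (\<Phi> (cmod (f x))) \<partial>M)
      = (\<integral>\<^sup>+x. liminf (\<lambda>n. ennreal (\<Phi> (cmod (f x) / k n))) \<partial>M)"
    using lim_imp_Liminf[OF sequentially_bot lim] by simp
  also have "\<dots> \<le> liminf (\<lambda>n. \<integral>\<^sup>+x. ennreal (\<Phi> (cmod (f x) / k n)) \<partial>M)"
    by (rule nn_integral_liminf) auto
  also have "\<dots> \<le> 1"
    using bd by (intro Liminf_le) auto
  finally show ?thesis .
qed

section \<open>The Orlicz space as a vector space, finite sums and indicators\<close>

lemma orlicz_space_mono:
  assumes "g \<in> orlicz_space M \<Phi>" "f \<in> borel_measurable M" "AE x in M. cmod (f x) \<le> cmod (g x)"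
  shows "f \<in> orlicz_space M \<Phi>"
proof -
  obtain k where k: "0 < k" "(\<integral>\<^sup>+x. ennreal (\<Phi> (k * cmod (g x))) \<partial>M) < \<infinity>"
    using assms(1) by (auto simp: orlicz_space_def)
  have "(\<integral>\<^sup>+x. ennreal (\<Phi> (k * cmod (f x))) \<partial>M) \<le> (\<integral>\<^sup>+x. ennreal (\<Phi> (k * cmod (g x))) \<partial>M)"
    using assms(3) k by (intro nn_integral_mono_AE)
      (auto elim!: eventually_mono intro!: ennreal_leI mono)
  then show ?thesis using assms(2) k by (auto simp: orlicz_space_def)
qed

lemma orlicz_space_add:
  assumes "f \<in> orlicz_space M \<Phi>" "g \<in> orlicz_space M \<Phi>"
  shows "(\<lambda>x. f x + g x) \<in> orlicz_space M \<Phi>"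
proof -
  note [measurable] = assms[THEN orlicz_space_measurable]
  obtain k where k: "0 < k" "(\<integral>\<^sup>+x. ennreal (\<Phi> (k * cmod (f x))) \<partial>M) < \<infinity>"
    using assms(1) by (auto simp: orlicz_space_def)
  obtain l where l: "0 < l" "(\<integral>\<^sup>+x. ennreal (\<Phi> (l * cmod (g x))) \<partial>M) < \<infinity>"
    using assms(2) by (auto simp: orlicz_space_def)
  \<comment> \<open>Half of the smaller scale: the factor 1/2 turns the sum into a midpoint, to
    which convexity applies.\<close>
  define m where "m = min k l / 2"
  have pw: "\<Phi> (m * cmod (f x + g x)) \<le> \<Phi> (k * cmod (f x)) + \<Phi> (l * cmod (g x))" for x
  proof -
    have "m * cmod (f x + g x) \<le> m * cmod (f x) + m * cmod (g x)"
      using norm_triangle_ineq[of "f x" "g x"] k l by (simp add: m_def flip: distrib_left)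
    also have "m * cmod (f x) \<le> 1/2 * (k * cmod (f x))"
      using mult_right_mono[of m "k/2" "cmod (f x)"] by (simp add: m_def)
    also have "m * cmod (g x) \<le> 1/2 * (l * cmod (g x))"
      using mult_right_mono[of m "l/2" "cmod (g x)"] by (simp add: m_def)
    finally have "\<Phi> (m * cmod (f x + g x)) \<le> \<Phi> (1/2 * (k * cmod (f x)) + 1/2 * (l * cmod (g x)))"
      using k l by (intro mono) (auto simp: m_def)
    also have "\<dots> \<le> 1/2 * \<Phi> (k * cmod (f x)) + 1/2 * \<Phi> (l * cmod (g x))"
      by (rule convex_comb) auto
    also have "\<dots> \<le> \<Phi> (k * cmod (f x)) + \<Phi> (l * cmod (g x))"
      using nonneg[of "k * cmod (f x)"] nonneg[of "l * cmod (g x)"] by linarith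
    finally show ?thesis .
  qed
  have "(\<integral>\<^sup>+x. ennreal (\<Phi> (m * cmod (f x + g x))) \<partial>M)
      \<le> (\<integral>\<^sup>+x. ennreal (\<Phi> (k * cmod (f x))) + ennreal (\<Phi> (l * cmod (g x))) \<partial>M)"
    using pw by (intro nn_integral_mono) (simp add: ennreal_leI flip: ennreal_plus)
  also have "\<dots> = (\<integral>\<^sup>+x. ennreal (\<Phi> (k * cmod (f x))) \<partial>M) + (\<integral>\<^sup>+x. ennreal (\<Phi> (l * cmod (g x))) \<partial>M)"
    by (simp add: nn_integral_add)
  also have "\<dots> < \<infinity>" using k l by simp
  finally show ?thesis using k l by (auto simp: orlicz_space_def m_def intro!: exI[of _ "min k l / 2"])
qed

lemma orlicz_space_cmult:
  assumes "f \<in> orlicz_space M \<Phi>"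
  shows "(\<lambda>x. c * f x) \<in> orlicz_space M \<Phi>"
proof (cases "c = 0")
  case False
  obtain k where k: "0 < k" "(\<integral>\<^sup>+x. ennreal (\<Phi> (k * cmod (f x))) \<partial>M) < \<infinity>"
    using assms by (auto simp: orlicz_space_def)
  then show ?thesis
    using False orlicz_space_measurable[OF assms]
    by (auto simp: orlicz_space_def norm_mult intro!: exI[of _ "k / cmod c"])
qed (auto simp: orlicz_space_def intro!: exI[of _ 1])

lemma orlicz_space_sum:
  "(\<And>i. i \<in> I \<Longrightarrow> f i \<in> orlicz_space M \<Phi>) \<Longrightarrow> (\<lambda>x. \<Sum>i\<in>I. f i x) \<in> orlicz_space M \<Phi>"
proof (induction I rule: infinite_finite_induct)
  case (insert i I) then show ?case by (simp add: orlicz_space_add)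
qed (auto simp: orlicz_space_def intro!: exI[of _ 1])

lemma orlicz_norm_sum_le:
  "(\<And>i. i \<in> I \<Longrightarrow> f i \<in> borel_measurable M) \<Longrightarrow>
    orlicz_norm M \<Phi> (\<lambda>x. \<Sum>i\<in>I. f i x) \<le> (\<Sum>i\<in>I. orlicz_norm M \<Phi> (f i))"
proof (induction I rule: infinite_finite_induct)
  case (insert i I)
  have "orlicz_norm M \<Phi> (\<lambda>x. \<Sum>i\<in>insert i I. f i x)
      \<le> orlicz_norm M \<Phi> (f i) + orlicz_norm M \<Phi> (\<lambda>x. \<Sum>i\<in>I. f i x)"
    using insert by (simp add: orlicz_norm_triangle)
  also have "\<dots> \<le> orlicz_norm M \<Phi> (f i) + (\<Sum>i\<in>I. orlicz_norm M \<Phi> (f i))"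
    using insert by (intro add_left_mono) simp
  finally show ?case using insert by simp
qed (auto simp: orlicz_norm_zero)

lemma orlicz_space_indicator:
  assumes "B \<in> sets M" "emeasure M B < \<infinity>"
  shows "indicator B \<in> orlicz_space M \<Phi>"
proof -
  have "(\<integral>\<^sup>+x. ennreal (\<Phi> (cmod (indicator B x))) \<partial>M) = (\<integral>\<^sup>+x. ennreal (\<Phi> 1) * indicator B x \<partial>M)"
    by (intro nn_integral_cong) (auto split: split_indicator)
  also have "\<dots> < \<infinity>" using assms by (simp add: nn_integral_cmult_indicator ennreal_mult_less_top)
  finally show ?thesis using assms by (auto simp: orlicz_space_def intro!: exI[of _ 1])
qed

text \<open>With \<open>m\<close> the measure of \<open>B\<close> and
  \<open>\<Phi> c = 1 / m\<close>, the admissible scales are exactly those at least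
  \<open>1 / c\<close>. So the norm is \<open>1 / c\<close>, the reciprocal of the inverse of
  \<open>\<Phi>\<close> at \<open>1 / m\<close>.\<close>

lemma orlicz_norm_indicator:
  assumes "B \<in> sets M" "0 < emeasure M B" "emeasure M B < \<infinity>"
  shows "\<exists>r>0. orlicz_norm M \<Phi> (indicator B) = ennreal r"
proof -
  obtain m where m: "emeasure M B = ennreal m" "0 < m"
    using assms by (cases "emeasure M B") auto
  obtain c where c: "0 \<le> c" "\<Phi> c = 1 / m" using surj[of "1 / m"] m by auto
  then have "0 < c" using m by (cases "c = 0") auto
  have mod: "(\<integral>\<^sup>+x. ennreal (\<Phi> (cmod (indicator B x) / k)) \<partial>M) \<le> 1 \<longleftrightarrow> 1 / c \<le> k" if "0 < k" for k
  proof -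
    have "(\<integral>\<^sup>+x. ennreal (\<Phi> (cmod (indicator B x) / k)) \<partial>M) = (\<integral>\<^sup>+x. ennreal (\<Phi> (1 / k)) * indicator B x \<partial>M)"
      by (intro nn_integral_cong) (auto split: split_indicator)
    also have "\<dots> = ennreal (\<Phi> (1 / k) * m)"
      using assms m by (simp add: nn_integral_cmult_indicator ennreal_mult)
    finally have "(\<integral>\<^sup>+x. ennreal (\<Phi> (cmod (indicator B x) / k)) \<partial>M) \<le> 1 \<longleftrightarrow> \<Phi> (1 / k) * m \<le> 1"
      by (simp flip: ennreal_1 add: ennreal_le_iff)
    also have "\<dots> \<longleftrightarrow> \<Phi> (1 / k) \<le> \<Phi> c"
      using c m by (simp add: pos_le_divide_eq)
    also have "\<dots> \<longleftrightarrow> 1 / c \<le> k" using \<open>0 < c\<close> that by (simp add: le_iff field_simps)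
    finally show ?thesis .
  qed
  have "orlicz_norm M \<Phi> (indicator B) = ennreal (1 / c)"
  proof (rule antisym)
    show "orlicz_norm M \<Phi> (indicator B) \<le> ennreal (1 / c)"
    proof (rule orlicz_norm_leI)
      show c': "0 < 1 / c" using \<open>0 < c\<close> by simp
      show "(\<integral>\<^sup>+x. ennreal (\<Phi> (cmod (indicator B x) / (1 / c))) \<partial>M) \<le> 1"
        using mod[OF c'] by blast
    qed
    show "ennreal (1 / c) \<le> orlicz_norm M \<Phi> (indicator B)"
      unfolding orlicz_norm_def by (intro INF_greatest ennreal_leI) (use mod in auto)
  qed
  then show ?thesis using \<open>0 < c\<close> by (intro exI[of _ "1 / c"]) simp
qed

end

section \<open>Conditional expectation and atoms\<close>

context sigma_finite_subalgebra
begin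

lemma space_F: "space F = space M"
  and sets_F: "A \<in> sets F \<Longrightarrow> A \<in> sets M"
  using subalg by (auto simp: subalgebra_def)

text \<open>Intersect an exhausting sequence of finite measure with the sublevel sets of
  \<open>h\<close>. This reduces almost-everywhere claims on the set where \<open>h\<close> is
  finite to countably many sets on which \<open>h\<close> is integrable; \<open>h = 0\<close>
  recovers sigma-finiteness.\<close>

lemma localization:
  assumes [measurable]: "h \<in> borel_measurable F"
  shows "\<exists>D :: nat \<Rightarrow> 'a set. (\<forall>n. D n \<in> sets F) \<and> (\<forall>n. emeasure M (D n) < \<infinity>) \<and>
    (\<forall>n. (\<integral>\<^sup>+x. indicator (D n) x * h x \<partial>M) < \<infinity>) \<and>
    (\<forall>x\<in>space M. h x < \<infinity> \<longrightarrow> (\<exists>n. x \<in> D n))"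
proof -
  obtain A :: "nat \<Rightarrow> 'a set" where A: "range A \<subseteq> sets (restr_to_subalg M F)"
    "(\<Union>i. A i) = space (restr_to_subalg M F)"
    "\<And>i. emeasure (restr_to_subalg M F) (A i) \<noteq> \<infinity>" "incseq A"
    using sigma_finite_measure.sigma_finite_incseq[OF sigma_fin_subalg] by metis
  have AF [measurable]: "A n \<in> sets F" for n
    using A(1) sets_restr_to_subalg[OF subalg] by auto
  have Afin: "emeasure M (A n) < \<infinity>" for n
    using A(3)[of n] emeasure_restr_to_subalg[OF subalg AF] by (simp add: top.not_eq_extremum)
  define D where "D n = {x \<in> A n. h x \<le> of_nat n}" for n
  have DF: "D n \<in> sets F" for n unfolding D_def by measurable
  have "emeasure M (D n) \<le> emeasure M (A n)" for n
    using AF by (intro emeasure_mono) (auto simp: D_def intro: sets_F)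
  then have Dfin: "emeasure M (D n) < \<infinity>" for n using Afin le_less_trans by blast
  have "(\<integral>\<^sup>+x. indicator (D n) x * h x \<partial>M) < \<infinity>" for n
  proof -
    have "(\<integral>\<^sup>+x. indicator (D n) x * h x \<partial>M) \<le> (\<integral>\<^sup>+x. of_nat n * indicator (D n) x \<partial>M)"
      by (intro nn_integral_mono) (auto simp: D_def split: split_indicator)
    also have "\<dots> = of_nat n * emeasure M (D n)"
      using DF by (simp add: nn_integral_cmult_indicator sets_F)
    also have "\<dots> < \<infinity>" using Dfin by (simp add: ennreal_mult_less_top of_nat_less_top)
    finally show ?thesis .
  qed
  moreover have "\<exists>n. x \<in> D n" if x: "x \<in> space M" "h x < \<infinity>" for x
  proof -
    obtain i where i: "x \<in> A i" using A(2) \<open>x \<in> space M\<close> by (auto simp: space_restr_to_subalg)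
    obtain m :: nat where "h x < of_nat m"
      using x(2) ennreal_Ex_less_of_nat[of "h x"] by auto
    moreover have "x \<in> A (max i m)" using i incseqD[OF A(4), of i "max i m"] by auto
    \<comment> \<open>The exhausting sets and the bounds both grow with the index, so one index
      serves both requirements.\<close>
    ultimately have "x \<in> D (max i m)"
      by (simp add: D_def order_trans[OF less_imp_le of_nat_mono])
    then show ?thesis ..
  qed
  ultimately show ?thesis using DF Dfin by blast
qed

text \<open>Countably many sets of finite measure cover \<open>G\<close>, so by subadditivity one of
  them meets \<open>G\<close> in positive measure.\<close>

lemma finite_positive_subset:
  assumes "G \<in> sets F" "0 < emeasure M G"
  obtains B where "B \<in> sets F" "B \<subseteq> G" "0 < emeasure M B" "emeasure M B < \<infinity>"
proof -
  obtain D :: "nat \<Rightarrow> 'a set" where D: "\<And>n. D n \<in> sets F" "\<And>n. emeasure M (D n) < \<infinity>"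
    "\<And>x. x \<in> space M \<Longrightarrow> \<exists>n. x \<in> D n"
    using localization[of "\<lambda>_. 0"] by simp blast
  have "G = (\<Union>n. G \<inter> D n)"
    using D(3) sets.sets_into_space[OF assms(1)] by (auto simp: space_F)
  then obtain n where n: "emeasure M (G \<inter> D n) \<noteq> 0"
    using emeasure_UN_eq_0[of M "\<lambda>n. G \<inter> D n"] assms D(1) by (force intro: sets_F)
  have "emeasure M (G \<inter> D n) \<le> emeasure M (D n)"
    using D(1) by (intro emeasure_mono) (auto intro: sets_F)
  also have "\<dots> < \<infinity>" by (rule D(2))
  finally show thesis
    using that[of "G \<inter> D n"] n assms(1) D(1) by (auto simp: zero_less_iff_neq_zero)
qed

section \<open>Atoms, and sets that are not finite unions of atoms\<close>

lemma atom_finite: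
  assumes "subalg_atom M F A" shows "emeasure M A < \<infinity>"
proof -
  obtain B where "B \<in> sets F" "B \<subseteq> A" "0 < emeasure M B" "emeasure M B < \<infinity>"
    using assms finite_positive_subset[of A] by (auto simp: subalg_atom_def)
  \<comment> \<open>The atom has the same measure as its non-null subset \<open>B\<close>, which is
    finite.\<close>
  then show ?thesis using assms by (force simp: subalg_atom_def)
qed

text \<open>The preimage of an open set is null or of full measure in the atom. Over a countable
  basis, almost all points of the atom thus have values in the same basic sets, and in a T1 space
  this determines the value.\<close>

lemma atom_const:
  fixes v :: "'a \<Rightarrow> 'b :: {second_countable_topology, t1_space}"
  assumes "subalg_atom M F A" and [measurable]: "v \<in> borel_measurable F"
  shows "\<exists>c. AE x in M. x \<in> A \<longrightarrow> v x = c"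
proof -
  have A [measurable]: "A \<in> sets F" "A \<in> sets M" and "0 < emeasure M A"
    using assms(1) by (auto simp: subalg_atom_def sets_F)
  have dich: "(AE x in M. x \<in> A \<longrightarrow> v x \<in> U) \<or> (AE x in M. x \<in> A \<longrightarrow> v x \<notin> U)" if "open U" for U
  proof -
    define B where "B = {x \<in> A. v x \<in> U}"
    have "B = (v -` U \<inter> space F) \<inter> A"
      using sets.sets_into_space[OF A(1)] by (auto simp: B_def)
    then have "B \<in> sets F" using \<open>open U\<close> by auto
    then have B: "B \<in> sets F" "B \<in> sets M" "B \<subseteq> A" by (auto simp: B_def sets_F)
    then consider "emeasure M B = 0" | "emeasure M B = emeasure M A"
      using assms(1) by (auto simp: subalg_atom_def)
    then show ?thesis
    proof cases
      case 1
      then have "AE x in M. x \<notin> B" using B by (intro AE_not_in) auto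
      then show ?thesis by (auto simp: B_def elim: eventually_mono)
    next
      case 2
      \<comment> \<open>Equality of measures gives a null difference only because an atom has finite
        measure.\<close>
      then have "emeasure M (A - B) = 0"
        using B A atom_finite[OF assms(1)] by (subst emeasure_Diff) auto
      then have "AE x in M. x \<notin> A - B" using B A by (intro AE_not_in) auto
      then show ?thesis by (auto simp: B_def elim: eventually_mono)
    qed
  qed
  obtain \<U> :: "'b set set" where \<U>: "countable \<U>" "topological_basis \<U>"
    using ex_countable_basis by blast
  have "AE x in M. \<forall>U\<in>\<U>. x \<in> A \<longrightarrow> (v x \<in> U \<longleftrightarrow> (AE y in M. y \<in> A \<longrightarrow> v y \<in> U))"
  proof (subst AE_ball_countable[OF \<U>(1)], intro ballI)
    fix U assume "U \<in> \<U>"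
    then have "open U" using \<U>(2) by (rule topological_basis_open[rotated])
    show "AE x in M. x \<in> A \<longrightarrow> (v x \<in> U \<longleftrightarrow> (AE y in M. y \<in> A \<longrightarrow> v y \<in> U))"
    proof (cases "AE y in M. y \<in> A \<longrightarrow> v y \<in> U")
      case False
      with dich[OF \<open>open U\<close>] show ?thesis by (auto elim: eventually_mono)
    qed (auto elim: eventually_mono)
  qed
  then have *: "AE x in M. x \<in> A \<longrightarrow> (\<forall>U\<in>\<U>. v x \<in> U \<longleftrightarrow> (AE y in M. y \<in> A \<longrightarrow> v y \<in> U))"
    by (auto elim: eventually_mono)
  \<comment> \<open>A null exceptional set cannot exhaust the atom, so some point has the generic
    pattern; its value is the constant.\<close>
  have "\<exists>x0. x0 \<in> A \<and> (\<forall>U\<in>\<U>. v x0 \<in> U \<longleftrightarrow> (AE y in M. y \<in> A \<longrightarrow> v y \<in> U))"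
  proof (rule ccontr)
    assume "\<not> ?thesis"
    with * have "AE x in M. x \<notin> A" by (auto elim!: eventually_mono)
    then show False using A \<open>0 < emeasure M A\<close> by (simp add: AE_iff_measurable[OF _ refl] AE_iff_null_sets null_setsD1)
  qed
  then obtain x0 where x0: "\<forall>U\<in>\<U>. v x0 \<in> U \<longleftrightarrow> (AE y in M. y \<in> A \<longrightarrow> v y \<in> U)" by blast
  have "v x = v x0" if "\<forall>U\<in>\<U>. v x \<in> U \<longleftrightarrow> (AE y in M. y \<in> A \<longrightarrow> v y \<in> U)" for x
  proof (rule ccontr)
    assume "v x \<noteq> v x0"
    then obtain W where W: "open W" "v x \<in> W" "v x0 \<notin> W" using t1_space by blast
    obtain U where "U \<in> \<U>" "v x \<in> U" "U \<subseteq> W"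
      using topological_basisE[OF \<U>(2) W(1,2)] by blast
    then show False using W(3) that x0 by blast
  qed
  with * have "AE x in M. x \<in> A \<longrightarrow> v x = v x0" by (auto elim: eventually_mono)
  then show ?thesis ..
qed

lemma finitely_many_atoms_Un:
  assumes "finitely_many_atoms M F G" "finitely_many_atoms M F H"
  shows "finitely_many_atoms M F (G \<union> H)"
proof -
  obtain \<G> \<H> where "finite \<G>" "\<forall>B\<in>\<G>. subalg_atom M F B" "AE x in M. x \<in> G \<longleftrightarrow> x \<in> \<Union>\<G>"
    "finite \<H>" "\<forall>B\<in>\<H>. subalg_atom M F B" "AE x in M. x \<in> H \<longleftrightarrow> x \<in> \<Union>\<H>"
    using assms unfolding finitely_many_atoms_def by blast
  then show ?thesis
    unfolding finitely_many_atoms_def by (intro exI[of _ "\<G> \<union> \<H>"]) auto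
qed

text \<open>Such a \<open>G\<close> is neither null (the empty union) nor an atom, so it splits into
  two non-null parts. They cannot both be finite unions of atoms; a part that is not is kept as
  \<open>H\<close>.\<close>

lemma not_finitely_many_atoms_split:
  assumes "G \<in> sets F" "\<not> finitely_many_atoms M F G"
  obtains H where "H \<in> sets F" "H \<subseteq> G" "\<not> finitely_many_atoms M F H" "0 < emeasure M (G - H)"
proof -
  have "0 < emeasure M G"
  proof (rule ccontr)
    assume "\<not> 0 < emeasure M G"
    then have "AE x in M. x \<notin> G" using assms(1) by (intro AE_not_in) (auto simp: sets_F)
    then have "finitely_many_atoms M F G"
      unfolding finitely_many_atoms_def by (intro exI[of _ "{}"]) auto
    then show False using assms by simp
  qed
  moreover have "\<not> subalg_atom M F G"
    using assms by (auto simp: finitely_many_atoms_def dest: spec[of _ "{G}"])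
  ultimately obtain B where B: "B \<in> sets F" "B \<subseteq> G" "emeasure M B \<noteq> 0" "emeasure M B \<noteq> emeasure M G"
    using assms(1) by (auto simp: subalg_atom_def)
  have "emeasure M B \<le> emeasure M G" using B assms by (intro emeasure_mono) (auto simp: sets_F)
  have "emeasure M (G - B) \<noteq> 0"
  proof
    assume 0: "emeasure M (G - B) = 0"
    \<comment> \<open>Additivity rather than subtraction is used, as these measures may be
      infinite.\<close>
    have "emeasure M G = emeasure M B + emeasure M (G - B)"
      using B assms by (subst plus_emeasure) (auto simp: sets_F Un_absorb1)
    with 0 B show False by simp
  qed
  have "\<not> finitely_many_atoms M F B \<or> \<not> finitely_many_atoms M F (G - B)"
    using finitely_many_atoms_Un[of B "G - B"] assms(2) B(2) by (auto simp: Un_absorb1)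
  then show thesis
  proof
    assume "\<not> finitely_many_atoms M F B"
    then show thesis using that[of B] B \<open>emeasure M (G - B) \<noteq> 0\<close> by (auto simp: zero_less_iff_neq_zero)
  next
    assume "\<not> finitely_many_atoms M F (G - B)"
    moreover have "G - (G - B) = B" using B by auto
    ultimately show thesis using that[of "G - B"] B assms by (auto simp: zero_less_iff_neq_zero)
  qed
qed

text \<open>Iterated splitting gives a decreasing sequence; the parts discarded at the successive
  stages are disjoint and non-null, and each is shrunk to finite measure.\<close>

lemma not_finitely_many_atoms_disjoint_family:
  assumes "G \<in> sets F" "\<not> finitely_many_atoms M F G"
  shows "\<exists>B :: nat \<Rightarrow> 'a set. disjoint_family B \<and>
    (\<forall>n. B n \<in> sets F \<and> B n \<subseteq> G \<and> 0 < emeasure M (B n) \<and> emeasure M (B n) < \<infinity>)"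
proof -
  have "\<exists>H. \<forall>n. (H n \<in> sets F \<and> H n \<subseteq> G \<and> \<not> finitely_many_atoms M F (H n)) \<and>
      (H (Suc n) \<subseteq> H n \<and> 0 < emeasure M (H n - H (Suc n)))"
  proof (rule dependent_nat_choice)
    show "\<exists>x. x \<in> sets F \<and> x \<subseteq> G \<and> \<not> finitely_many_atoms M F x" using assms by blast
  next
    fix x :: "'a set" and n :: nat
    assume "x \<in> sets F \<and> x \<subseteq> G \<and> \<not> finitely_many_atoms M F x"
    then show "\<exists>y. (y \<in> sets F \<and> y \<subseteq> G \<and> \<not> finitely_many_atoms M F y) \<and> (y \<subseteq> x \<and> 0 < emeasure M (x - y))"
      using not_finitely_many_atoms_split[of x] by (metis subset_trans)
  qed
  then obtain H where H: "\<And>n. H n \<in> sets F" "\<And>n. H n \<subseteq> G" "\<And>n. H (Suc n) \<subseteq> H n"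
    "\<And>n. 0 < emeasure M (H n - H (Suc n))" by blast
  have "\<exists>B. B \<in> sets F \<and> B \<subseteq> H n - H (Suc n) \<and> 0 < emeasure M B \<and> emeasure M B < \<infinity>" for n
    using finite_positive_subset[of "H n - H (Suc n)"] H by (metis sets.Diff)
  then obtain B where B: "\<And>n. B n \<in> sets F" "\<And>n. B n \<subseteq> H n - H (Suc n)"
    "\<And>n. 0 < emeasure M (B n)" "\<And>n. emeasure M (B n) < \<infinity>" by metis
  have "disjoint_family (\<lambda>n. H n - H (Suc n))"
  proof -
    have "decseq H" using H(3) by (rule decseq_SucI)
    then have "(H m - H (Suc m)) \<inter> (H n - H (Suc n)) = {}" if "m < n" for m n
      using that decseqD[of H "Suc m" n] by auto
    then show ?thesis unfolding disjoint_family_on_def by (metis Int_commute linorder_neqE_nat)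
  qed
  then have "disjoint_family B"
    using B(2) unfolding disjoint_family_on_def by blast
  then show ?thesis using B H(2) by blast
qed

section \<open>Pulling out indicators, and the modulus inequality for complex conditional
  expectation\<close>

lemma nn_cond_exp_indicator:
  assumes "D \<in> sets F" and [measurable]: "f \<in> borel_measurable M"
  shows "AE x in M. nn_cond_exp M F (\<lambda>x. indicator D x * f x) x = indicator D x * nn_cond_exp M F f x"
proof -
  have "indicator D \<in> borel_measurable F" using assms(1) by simp
  from nn_cond_exp_prod[OF this assms(2)] show ?thesis by (auto elim: eventually_mono)
qed

text \<open>\<open>f\<close> is only measurable, so the indicator is pulled out of the positive and
  negative parts separately, without passing through integrability.\<close>

lemma real_cond_exp_indicator:
  assumes "D \<in> sets F" and [measurable]: "f \<in> borel_measurable M"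
  shows "AE x in M. real_cond_exp M F (\<lambda>x. indicator D x * f x) x = indicator D x * real_cond_exp M F f x"
proof -
  have eq: "(\<lambda>x. ennreal (indicator D x * f x)) = (\<lambda>x. indicator D x * ennreal (f x))"
    "(\<lambda>x. ennreal (- (indicator D x * f x))) = (\<lambda>x. indicator D x * ennreal (- f x))"
    by (auto split: split_indicator)
  have "AE x in M. nn_cond_exp M F (\<lambda>x. indicator D x * ennreal (f x)) x
      = indicator D x * nn_cond_exp M F (\<lambda>x. ennreal (f x)) x"
    "AE x in M. nn_cond_exp M F (\<lambda>x. indicator D x * ennreal (- f x)) x
      = indicator D x * nn_cond_exp M F (\<lambda>x. ennreal (- f x)) x"
    using assms(1) by (auto intro!: nn_cond_exp_indicator)
  then show ?thesis
    unfolding real_cond_exp_def eq by eventually_elim (simp split: split_indicator)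
qed

lemma complex_cond_exp_indicator:
  assumes "D \<in> sets F" and [measurable]: "f \<in> borel_measurable M"
  shows "AE x in M. complex_cond_exp M F (\<lambda>x. indicator D x * f x) x
    = indicator D x * complex_cond_exp M F f x"
proof -
  have eq: "Re (indicator D x * f x) = indicator D x * Re (f x)"
    "Im (indicator D x * f x) = indicator D x * Im (f x)" for x
    by (auto split: split_indicator)
  have "AE x in M. real_cond_exp M F (\<lambda>x. indicator D x * Re (f x)) x
      = indicator D x * real_cond_exp M F (\<lambda>x. Re (f x)) x"
    "AE x in M. real_cond_exp M F (\<lambda>x. indicator D x * Im (f x)) x
      = indicator D x * real_cond_exp M F (\<lambda>x. Im (f x)) x"
    using assms(1) by (auto intro!: real_cond_exp_indicator)
  then show ?thesis
    unfolding complex_cond_exp_def eq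
    by eventually_elim (simp add: complex_eq_iff split: split_indicator)
qed

lemma complex_cond_exp_measurable [measurable]:
  "complex_cond_exp M F f \<in> borel_measurable F" "complex_cond_exp M F f \<in> borel_measurable M"
  unfolding complex_cond_exp_def by (auto simp: borel_measurable_complex_iff)

end

text \<open>The modulus is a supremum over directions, and rational directions suffice by density.
  Having only countably many conditions allows the criterion to be used almost everywhere.\<close>

lemma sqrt_sum_squares_leI:
  fixes a b r :: real
  assumes "\<And>p q. p \<in> \<rat> \<Longrightarrow> q \<in> \<rat> \<Longrightarrow> p * a + q * b \<le> sqrt (p\<^sup>2 + q\<^sup>2) * r"
  shows "sqrt (a\<^sup>2 + b\<^sup>2) \<le> r"
proof -
  obtain p where p: "\<And>n. p n \<in> \<rat>" "p \<longlonglongrightarrow> a"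
    using closure_sequential[of a "\<rat>"] Rats_closure_real by auto
  obtain q where q: "\<And>n. q n \<in> \<rat>" "q \<longlonglongrightarrow> b"
    using closure_sequential[of b "\<rat>"] Rats_closure_real by auto
  have "a * a + b * b \<le> sqrt (a\<^sup>2 + b\<^sup>2) * r"
  proof (rule LIMSEQ_le)
    show "(\<lambda>n. p n * a + q n * b) \<longlonglongrightarrow> a * a + b * b" using p q by (intro tendsto_intros)
    show "(\<lambda>n. sqrt ((p n)\<^sup>2 + (q n)\<^sup>2) * r) \<longlonglongrightarrow> sqrt (a\<^sup>2 + b\<^sup>2) * r"
      using p q by (intro tendsto_intros)
    show "\<exists>N. \<forall>n\<ge>N. p n * a + q n * b \<le> sqrt ((p n)\<^sup>2 + (q n)\<^sup>2) * r" using assms p q by auto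
  qed
  then have le: "sqrt (a\<^sup>2 + b\<^sup>2) * sqrt (a\<^sup>2 + b\<^sup>2) \<le> sqrt (a\<^sup>2 + b\<^sup>2) * r"
    by (simp add: power2_eq_square)
  show ?thesis
  proof (cases "sqrt (a\<^sup>2 + b\<^sup>2) = 0")
    case True
    then have "a = 0" by (simp add: sum_power2_eq_zero_iff)
    \<comment> \<open>Cancelling the modulus is impossible here; the direction (1, 0) yields
      \<open>0 \<le> r\<close> instead.\<close>
    then show ?thesis using assms[of 1 0] True by simp
  next
    case False
    moreover have "0 \<le> sqrt (a\<^sup>2 + b\<^sup>2)" by simp
    ultimately have "0 < sqrt (a\<^sup>2 + b\<^sup>2)" by linarith
    with le show ?thesis by (rule mult_left_le_imp_le)
  qed
qed

context sigma_finite_subalgebra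
begin

text \<open>For a fixed direction \<open>(p, q)\<close>, the Cauchy-Schwarz inequality with
  linearity and monotonicity of the real conditional expectation bounds that component. Intersecting
  over rational directions gives the modulus.\<close>

lemma cmod_complex_cond_exp_le_integrable:
  assumes int: "integrable M f"
  shows "AE x in M. ennreal (cmod (complex_cond_exp M F f x)) \<le> nn_cond_exp M F (\<lambda>x. ennreal (cmod (f x))) x"
proof -
  let ?a = "real_cond_exp M F (\<lambda>x. Re (f x))" and ?b = "real_cond_exp M F (\<lambda>x. Im (f x))"
  let ?r = "real_cond_exp M F (\<lambda>x. cmod (f x))"
  have [measurable]: "f \<in> borel_measurable M" using int by simp
  have i: "integrable M (\<lambda>x. Re (f x))" "integrable M (\<lambda>x. Im (f x))" "integrable M (\<lambda>x. cmod (f x))"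
    using int by auto
  have "AE x in M. p * ?a x + q * ?b x \<le> sqrt (p\<^sup>2 + q\<^sup>2) * ?r x" for p q
  proof -
    have le: "p * Re z + q * Im z \<le> sqrt (p\<^sup>2 + q\<^sup>2) * cmod z" for z
      using norm_cauchy_schwarz[of "Complex p q" z] by (simp add: inner_complex_def cmod_def)
    have "AE x in M. real_cond_exp M F (\<lambda>x. p * Re (f x) + q * Im (f x)) x
        = real_cond_exp M F (\<lambda>x. p * Re (f x)) x + real_cond_exp M F (\<lambda>x. q * Im (f x)) x"
      using i by (intro real_cond_exp_add) auto
    moreover have "AE x in M. real_cond_exp M F (\<lambda>x. p * Re (f x) + q * Im (f x)) x
        \<le> real_cond_exp M F (\<lambda>x. sqrt (p\<^sup>2 + q\<^sup>2) * cmod (f x)) x"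
      using i le by (intro real_cond_exp_mono) auto
    moreover note real_cond_exp_cmult[OF i(1), of p] real_cond_exp_cmult[OF i(2), of q]
      real_cond_exp_cmult[OF i(3), of "sqrt (p\<^sup>2 + q\<^sup>2)"]
    ultimately show ?thesis by eventually_elim simp
  qed
  then have "AE x in M. \<forall>p\<in>\<rat>. \<forall>q\<in>\<rat>. p * ?a x + q * ?b x \<le> sqrt (p\<^sup>2 + q\<^sup>2) * ?r x"
    by (simp add: AE_ball_countable countable_rat)
  moreover have "AE x in M. ennreal \<bar>?r x\<bar> \<le> nn_cond_exp M F (\<lambda>x. ennreal \<bar>cmod (f x)\<bar>) x"
    by (intro real_cond_exp_abs) auto
  ultimately show ?thesis
  proof eventually_elim
    case (elim x)
    have "cmod (complex_cond_exp M F f x) \<le> ?r x"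
      using elim(1) unfolding complex_cond_exp_def by (simp add: cmod_def sqrt_sum_squares_leI)
    then have "ennreal (cmod (complex_cond_exp M F f x)) \<le> ennreal \<bar>?r x\<bar>"
      by (intro ennreal_leI) simp
    also have "\<dots> \<le> nn_cond_exp M F (\<lambda>x. ennreal (cmod (f x))) x" using elim(2) by simp
    finally show ?case .
  qed
qed

text \<open>Integrability is removed by localization: \<open>f\<close> is integrable on each
  \<open>D n\<close>, and these sets cover the points where the conditional expectation of
  \<open>cmod f\<close> is finite.\<close>

lemma cmod_complex_cond_exp_le:
  assumes [measurable]: "f \<in> borel_measurable M"
  shows "AE x in M. nn_cond_exp M F (\<lambda>x. ennreal (cmod (f x))) x < \<infinity> \<longrightarrow>
    ennreal (cmod (complex_cond_exp M F f x)) \<le> nn_cond_exp M F (\<lambda>x. ennreal (cmod (f x))) x"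
proof -
  let ?h = "nn_cond_exp M F (\<lambda>x. ennreal (cmod (f x)))"
  obtain D :: "nat \<Rightarrow> 'a set" where D [measurable]: "\<And>n. D n \<in> sets F"
    and Dint: "\<And>n. (\<integral>\<^sup>+x. indicator (D n) x * ?h x \<partial>M) < \<infinity>"
    and Dcov: "\<And>x. x \<in> space M \<Longrightarrow> ?h x < \<infinity> \<Longrightarrow> \<exists>n. x \<in> D n"
    using localization[of ?h, OF borel_measurable_nn_cond_exp] by blast
  note [measurable] = sets_F[OF D]
  have "AE x in M. x \<in> D n \<longrightarrow> ennreal (cmod (complex_cond_exp M F f x)) \<le> ?h x" for n
  proof -
    have eq: "ennreal (cmod (indicator (D n) x * f x)) = indicator (D n) x * ennreal (cmod (f x))" for x
      by (auto split: split_indicator)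
    have "(\<integral>\<^sup>+x. indicator (D n) x * ennreal (cmod (f x)) \<partial>M) = (\<integral>\<^sup>+x. indicator (D n) x * ?h x \<partial>M)"
      by (rule nn_cond_exp_intg[symmetric]) auto
    then have "integrable M (\<lambda>x. indicator (D n) x * f x)"
      using Dint[of n] by (intro integrableI_bounded) (auto simp: eq)
    from cmod_complex_cond_exp_le_integrable[OF this]
      complex_cond_exp_indicator[OF D assms, of n]
      nn_cond_exp_indicator[OF D, of "\<lambda>x. ennreal (cmod (f x))" n]
    show ?thesis unfolding eq by (auto elim!: eventually_elim2 split: split_indicator)
  qed
  then have "AE x in M. \<forall>n. x \<in> D n \<longrightarrow> ennreal (cmod (complex_cond_exp M F f x)) \<le> ?h x"
    unfolding AE_all_countable by blast
  then show ?thesis using AE_space by eventually_elim (use Dcov in blast)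
qed

end

section \<open>Operators on the Orlicz space\<close>

lemma orlicz_linearD:
  assumes "orlicz_linear M \<Phi> T"
  shows "f \<in> orlicz_space M \<Phi> \<Longrightarrow> T f \<in> orlicz_space M \<Phi>"
    and "f \<in> orlicz_space M \<Phi> \<Longrightarrow> g \<in> orlicz_space M \<Phi> \<Longrightarrow> AE x in M. f x = g x \<Longrightarrow>
      AE x in M. T f x = T g x"
    and "f \<in> orlicz_space M \<Phi> \<Longrightarrow> g \<in> orlicz_space M \<Phi> \<Longrightarrow>
      AE x in M. T (\<lambda>y. f y + g y) x = T f x + T g x"
    and "f \<in> orlicz_space M \<Phi> \<Longrightarrow> AE x in M. T (\<lambda>y. c * f y) x = c * T f x"
  using assms by (auto simp: orlicz_linear_def)

text \<open>Bolzano-Weierstrass is applied to one index at a time; convergence already obtained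
  survives passage to a further subsequence.\<close>

lemma finite_family_convergent_subsequence:
  fixes c :: "nat \<Rightarrow> 'i \<Rightarrow> 'b :: heine_borel"
  assumes "finite I" "\<And>i. i \<in> I \<Longrightarrow> bounded (range (\<lambda>n. c n i))"
  shows "\<exists>r l. strict_mono (r :: nat \<Rightarrow> nat) \<and> (\<forall>i\<in>I. (\<lambda>n. c (r n) i) \<longlonglongrightarrow> l i)"
  using assms
proof (induction I rule: finite_induct)
  case empty
  then show ?case by (intro exI[of _ id]) (simp add: strict_mono_id)
next
  case (insert i I)
  then obtain r l where r: "strict_mono (r :: nat \<Rightarrow> nat)" "\<forall>i\<in>I. (\<lambda>n. c (r n) i) \<longlonglongrightarrow> l i" by auto
  have "bounded (range (\<lambda>n. c (r n) i))"
    using insert.prems[of i] by (rule bounded_subset) auto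
  then obtain m s where s: "strict_mono (s :: nat \<Rightarrow> nat)" "((\<lambda>n. c (r n) i) \<circ> s) \<longlonglongrightarrow> m"
    using bounded_imp_convergent_subsequence by blast
  have "(\<lambda>n. c ((r \<circ> s) n) j) \<longlonglongrightarrow> (l(i := m)) j" if "j \<in> insert i I" for j
  proof (cases "j = i")
    case False
    with that r(2) have "(\<lambda>n. c (r n) j) \<longlonglongrightarrow> l j" by auto
    from LIMSEQ_subseq_LIMSEQ[OF this s(1)] False show ?thesis by (simp add: o_def)
  qed (use s in \<open>simp add: o_def\<close>)
  with strict_mono_o[OF r(1) s(1)] show ?case by blast
qed

context young
begin

lemma orlicz_linear_indicator_mult:
  assumes "orlicz_linear M \<Phi> T" "B \<in> sets M"
  shows "orlicz_linear M \<Phi> (\<lambda>f x. indicator B x * T f x)"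
  unfolding orlicz_linear_def
proof (intro conjI ballI allI impI)
  note T = orlicz_linearD[OF assms(1)]
  fix f assume f: "f \<in> orlicz_space M \<Phi>"
  note [measurable] = orlicz_space_measurable[OF T(1)[OF f]]
  show "(\<lambda>x. indicator B x * T f x) \<in> orlicz_space M \<Phi>"
    using T(1)[OF f]
  proof (rule orlicz_space_mono)
    show "(\<lambda>x. indicator B x * T f x) \<in> borel_measurable M" using assms(2) by measurable
  qed (auto split: split_indicator)
  show "AE x in M. indicator B x * T (\<lambda>y. c * f y) x = c * (indicator B x * T f x)" for c
    using T(4)[OF f, of c] by eventually_elim simp
  fix g assume g: "g \<in> orlicz_space M \<Phi>"
  show "AE x in M. indicator B x * T (\<lambda>y. f y + g y) x = indicator B x * T f x + indicator B x * T g x"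
    using T(3)[OF f g] by eventually_elim (simp add: distrib_left)
  assume "AE x in M. f x = g x"
  from T(2)[OF f g this] show "AE x in M. indicator B x * T f x = indicator B x * T g x"
    by eventually_elim simp
qed

lemma orlicz_space_diff:
  "f \<in> orlicz_space M \<Phi> \<Longrightarrow> g \<in> orlicz_space M \<Phi> \<Longrightarrow> (\<lambda>x. f x - g x) \<in> orlicz_space M \<Phi>"
  using orlicz_space_add[of f M "\<lambda>x. (- 1) * g x"] orlicz_space_cmult[of g M "- 1"] by simp

lemma orlicz_linear_diff:
  assumes "orlicz_linear M \<Phi> T" "orlicz_linear M \<Phi> S"
  shows "orlicz_linear M \<Phi> (\<lambda>f x. T f x - S f x)"
  unfolding orlicz_linear_def
proof (intro conjI ballI allI impI)
  note T = orlicz_linearD[OF assms(1)] and S = orlicz_linearD[OF assms(2)]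
  fix f assume f: "f \<in> orlicz_space M \<Phi>"
  show "(\<lambda>x. T f x - S f x) \<in> orlicz_space M \<Phi>"
    using T(1)[OF f] S(1)[OF f] by (rule orlicz_space_diff)
  show "AE x in M. T (\<lambda>y. c * f y) x - S (\<lambda>y. c * f y) x = c * (T f x - S f x)" for c
    using T(4)[OF f, of c] S(4)[OF f, of c] by eventually_elim (simp add: algebra_simps)
  fix g assume g: "g \<in> orlicz_space M \<Phi>"
  show "AE x in M. T (\<lambda>y. f y + g y) x - S (\<lambda>y. f y + g y) x = T f x - S f x + (T g x - S g x)"
    using T(3)[OF f g] S(3)[OF f g] by eventually_elim simp
  assume "AE x in M. f x = g x"
  from T(2)[OF f g this] S(2)[OF f g this] show "AE x in M. T f x - S f x = T g x - S g x"
    by eventually_elim simp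
qed

text \<open>The operator norm only sees the unit ball, so \<open>h\<close> is rescaled by
  \<open>1 / t\<close>; linearity and homogeneity of the norm undo the scaling.\<close>

lemma orlicz_norm_le_opnorm:
  assumes T: "orlicz_linear M \<Phi> T" and h: "h \<in> orlicz_space M \<Phi>" "orlicz_norm M \<Phi> h = ennreal t" "0 < t"
  shows "orlicz_norm M \<Phi> (T h) \<le> orlicz_opnorm M \<Phi> T * ennreal t"
proof -
  let ?N = "orlicz_norm M \<Phi>"
  define c where "c = complex_of_real (1 / t)"
  have c: "ennreal (cmod c) = ennreal (1 / t)" using h(3) by (simp add: c_def norm_divide)
  have inv: "ennreal t * (ennreal (1 / t) * x) = x" for x
    using h(3) by (simp add: mult.assoc[symmetric] flip: ennreal_mult)
  have "?N (\<lambda>x. c * h x) = 1"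
    using h(3) by (simp add: orlicz_norm_cmult h(2) c flip: ennreal_mult)
  then have "(\<lambda>x. c * h x) \<in> {f \<in> orlicz_space M \<Phi>. ?N f \<le> 1}"
    using orlicz_space_cmult[OF h(1)] by simp
  then have "?N (T (\<lambda>x. c * h x)) \<le> orlicz_opnorm M \<Phi> T"
    unfolding orlicz_opnorm_def by (rule SUP_upper)
  also have "?N (T (\<lambda>x. c * h x)) = ?N (\<lambda>x. c * T h x)"
    by (intro orlicz_norm_cong orlicz_linearD[OF T] h(1))
  also have "\<dots> = ennreal (1 / t) * ?N (T h)"
    by (simp only: orlicz_norm_cmult c)
  finally have "ennreal t * (ennreal (1 / t) * ?N (T h)) \<le> ennreal t * orlicz_opnorm M \<Phi> T"
    by (rule mult_left_mono) simp
  then have "?N (T h) \<le> ennreal t * orlicz_opnorm M \<Phi> T" by (simp only: inv)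
  then show ?thesis by (simp add: mult.commute)
qed

end

section \<open>Compact truncations and the upper bound for the essential norm\<close>

locale young_subalgebra = young \<Phi> + sigma_finite_subalgebra M F
  for \<Phi> :: "real \<Rightarrow> real" and M F :: "'a measure"
begin

text \<open>An image under \<open>R\<close> is constant on every atom, so a truncated image is
  determined by finitely many coefficients. They stay bounded on the unit ball, and convergence of
  the coefficients gives convergence in norm.\<close>

lemma compact_restriction_to_atoms:
  fixes A :: "'i \<Rightarrow> 'a set"
  assumes R: "orlicz_bounded_linear M \<Phi> R" "\<And>f. R f \<in> borel_measurable F"
    and I: "finite I" "\<And>i. i \<in> I \<Longrightarrow> subalg_atom M F (A i)" "disjoint_family_on A I"
  shows "orlicz_compact_op M \<Phi> (\<lambda>f x. indicator (\<Union>i\<in>I. A i) x * R f x)"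
  unfolding orlicz_compact_op_def
proof (intro conjI allI impI)
  let ?B = "\<Union>i\<in>I. A i" and ?N = "orlicz_norm M \<Phi>"
  have lin: "orlicz_linear M \<Phi> R" using R(1) by (simp add: orlicz_bounded_linear_def)
  obtain K0 where K0: "\<And>f. f \<in> orlicz_space M \<Phi> \<Longrightarrow> ?N (R f) \<le> ennreal K0 * ?N f"
    using R(1) by (auto simp: orlicz_bounded_linear_def)
  \<comment> \<open>A negative \<open>K0\<close> is read as 0 by \<open>ennreal\<close>; the real
    estimate of the coefficients requires a nonnegative constant.\<close>
  define K where "K = max K0 0"
  then have "0 \<le> K" by simp
  have AM [measurable]: "A i \<in> sets M" if "i \<in> I" for i
    using I(2)[OF that] by (auto simp: subalg_atom_def sets_F)
  have Afin: "emeasure M (A i) < \<infinity>" "0 < emeasure M (A i)" if "i \<in> I" for i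
    using I(2)[OF that] atom_finite by (auto simp: subalg_atom_def)
  show "orlicz_linear M \<Phi> (\<lambda>f x. indicator ?B x * R f x)"
    using lin AM I(1) by (intro orlicz_linear_indicator_mult) auto
  fix f :: "nat \<Rightarrow> 'a \<Rightarrow> complex"
  assume f: "\<forall>n. f n \<in> orlicz_space M \<Phi> \<and> ?N (f n) \<le> 1"
  have NR: "?N (R (f n)) \<le> ennreal K" for n
  proof -
    have "?N (R (f n)) \<le> ennreal K0 * 1" using f K0[of "f n"] by (meson mult_left_mono order_trans zero_le)
    also have "\<dots> \<le> ennreal K" by (auto simp: K_def intro: ennreal_leI)
    finally show ?thesis .
  qed
  have "\<exists>c. AE x in M. x \<in> A i \<longrightarrow> R (f n) x = c" if "i \<in> I" for n i
    by (rule atom_const[OF I(2)[OF that] R(2)])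
  then have "\<forall>n. \<exists>c. \<forall>i\<in>I. AE x in M. x \<in> A i \<longrightarrow> R (f n) x = c i"
    by (intro allI bchoice ballI)
  from choice[OF this] obtain c
    where c: "\<And>n i. i \<in> I \<Longrightarrow> AE x in M. x \<in> A i \<longrightarrow> R (f n) x = c n i" by blast
  have "\<exists>\<rho>>0. ?N (indicator (A i)) = ennreal \<rho>" if "i \<in> I" for i
    by (rule orlicz_norm_indicator[OF AM[OF that] Afin(2,1)[OF that]])
  then have "\<exists>\<rho>. \<forall>i\<in>I. 0 < \<rho> i \<and> ?N (indicator (A i)) = ennreal (\<rho> i)"
    by (intro bchoice ballI)
  then obtain \<rho> where \<rho>: "\<And>i. i \<in> I \<Longrightarrow> 0 < \<rho> i" "\<And>i. i \<in> I \<Longrightarrow> ?N (indicator (A i)) = ennreal (\<rho> i)"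
    by blast
  have "cmod (c n i) \<le> K / \<rho> i" if "i \<in> I" for n i
  proof -
    \<comment> \<open>On \<open>A i\<close> the image coincides with its coefficient, so the norm of
      this single piece is dominated by the norm of the whole image.\<close>
    have "ennreal (cmod (c n i)) * ennreal (\<rho> i) = ?N (\<lambda>x. c n i * indicator (A i) x)"
      using \<rho> that by (simp add: orlicz_norm_cmult)
    also have "\<dots> \<le> ?N (R (f n))"
      using c[OF that, of n] by (intro orlicz_norm_mono) (auto elim!: eventually_mono split: split_indicator)
    also have "\<dots> \<le> ennreal K" by (rule NR)
    finally have "cmod (c n i) * \<rho> i \<le> K"
      using \<rho>(1)[OF that] \<open>0 \<le> K\<close> by (simp add: less_imp_le flip: ennreal_mult)
    then show ?thesis using \<rho>(1)[OF that] by (simp add: field_simps)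
  qed
  then have bd: "bounded (range (\<lambda>n. c n i))" if "i \<in> I" for i
    using that by (intro boundedI[of _ "K / \<rho> i"]) auto
  obtain r l where r: "strict_mono (r :: nat \<Rightarrow> nat)" and l: "\<And>i. i \<in> I \<Longrightarrow> (\<lambda>n. c (r n) i) \<longlonglongrightarrow> l i"
    using finite_family_convergent_subsequence[of I c, OF I(1) bd] by blast
  define g where "g x = (\<Sum>i\<in>I. l i * indicator (A i) x)" for x
  have g: "g \<in> orlicz_space M \<Phi>"
    unfolding g_def by (intro orlicz_space_sum orlicz_space_cmult orlicz_space_indicator AM Afin)
  have le: "?N (\<lambda>x. indicator ?B x * R (f n) x - g x) \<le> ennreal (\<Sum>i\<in>I. cmod (c n i - l i) * \<rho> i)" for n
  proof -
    have "AE x in M. \<forall>i\<in>I. x \<in> A i \<longrightarrow> R (f n) x = c n i"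
      using c I(1) by (simp add: AE_ball_countable countable_finite)
    then have "AE x in M. indicator ?B x * R (f n) x - g x = (\<Sum>i\<in>I. (c n i - l i) * indicator (A i) x)"
    proof eventually_elim
      case (elim x)
      have "indicator ?B x * R (f n) x = (\<Sum>i\<in>I. indicator (A i) x * R (f n) x)"
        by (simp add: indicator_UN_disjoint[OF I(1,3)] sum_distrib_right)
      also have "\<dots> = (\<Sum>i\<in>I. c n i * indicator (A i) x)"
        using elim by (intro sum.cong) (auto split: split_indicator)
      finally show ?case by (simp add: g_def left_diff_distrib sum_subtractf)
    qed
    then have "?N (\<lambda>x. indicator ?B x * R (f n) x - g x) = ?N (\<lambda>x. \<Sum>i\<in>I. (c n i - l i) * indicator (A i) x)"
      by (rule orlicz_norm_cong)
    also have "\<dots> \<le> (\<Sum>i\<in>I. ?N (\<lambda>x. (c n i - l i) * indicator (A i) x))"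
      by (rule orlicz_norm_sum_le) (use AM in measurable)
    also have "\<dots> = (\<Sum>i\<in>I. ennreal (cmod (c n i - l i) * \<rho> i))"
      using \<rho> by (intro sum.cong) (auto simp: orlicz_norm_cmult ennreal_mult less_imp_le)
    also have "\<dots> = ennreal (\<Sum>i\<in>I. cmod (c n i - l i) * \<rho> i)"
      using \<rho> by (intro sum_ennreal) (auto simp: less_imp_le)
    finally show ?thesis .
  qed
  have "(\<lambda>n. \<Sum>i\<in>I. cmod (c (r n) i - l i) * \<rho> i) \<longlonglongrightarrow> (\<Sum>i\<in>I. cmod (l i - l i) * \<rho> i)"
    using l by (intro tendsto_intros)
  then have "(\<lambda>n. ennreal (\<Sum>i\<in>I. cmod (c (r n) i - l i) * \<rho> i)) \<longlonglongrightarrow> 0"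
    by (simp flip: ennreal_0 add: tendsto_ennrealI del: ennreal_0)
  from tendsto_sandwich[OF _ _ tendsto_const this]
  have "(\<lambda>n. ?N (\<lambda>x. indicator ?B x * R (f (r n)) x - g x)) \<longlonglongrightarrow> 0"
    using le by simp
  with r g show "\<exists>r. strict_mono r \<and> (\<exists>g\<in>orlicz_space M \<Phi>.
      (\<lambda>n. ?N (\<lambda>x. indicator ?B x * R (f (r n)) x - g x)) \<longlonglongrightarrow> 0)" by blast
qed

text \<open>Off \<open>B\<close>, the GCH-inequality makes \<open>C * \<epsilon>\<close> times the
  inverse of \<open>\<Phi>\<close> at \<open>?t\<close> a bound for the image. Dividing by
  \<open>C * \<epsilon>\<close> and applying \<open>\<Phi>\<close> leaves at most \<open>?t\<close>,
  whose integral equals the modular of \<open>f\<close> and so is at most 1.\<close>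

lemma opnorm_off_set_le:
  fixes u :: "'a \<Rightarrow> complex"
  assumes conj: "young_function (young_conj \<Phi>)" and u [measurable]: "u \<in> borel_measurable M"
    and bdd: "cond_exp_mult_bounded M F \<Phi> u"
    and gch: "GCH_inequality M F \<Phi> C" and pos: "0 < C" "0 < \<epsilon>"
    and B: "AE x in M. x \<notin> B \<longrightarrow> young_inv (young_conj \<Phi>)
      (nn_cond_exp M F (\<lambda>x. ennreal (young_conj \<Phi> (cmod (u x)))) x) < ennreal \<epsilon>"
  shows "orlicz_opnorm M \<Phi> (\<lambda>f x. cond_exp_mult M F u f x - indicator B x * cond_exp_mult M F u f x)
    \<le> ennreal (C * \<epsilon>)"
  unfolding orlicz_opnorm_def
proof (rule SUP_least)
  interpret conj: young "young_conj \<Phi>" by standard fact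
  let ?h = "nn_cond_exp M F (\<lambda>x. ennreal (young_conj \<Phi> (cmod (u x))))"
  fix f assume "f \<in> {f \<in> orlicz_space M \<Phi>. orlicz_norm M \<Phi> f \<le> 1}"
  then have f: "f \<in> orlicz_space M \<Phi>" and mod: "(\<integral>\<^sup>+x. ennreal (\<Phi> (cmod (f x))) \<partial>M) \<le> 1"
    using modular_le_1[OF orlicz_space_measurable] by auto
  note [measurable] = orlicz_space_measurable[OF f]
  let ?t = "nn_cond_exp M F (\<lambda>x. ennreal (\<Phi> (cmod (f x))))"
  let ?E = "nn_cond_exp M F (\<lambda>x. ennreal (cmod (u x * f x)))"
  have int_t: "(\<integral>\<^sup>+x. ?t x \<partial>M) \<le> 1"
    using mod nn_cond_exp_intg[of "\<lambda>_. 1" "\<lambda>x. ennreal (\<Phi> (cmod (f x)))"] by simp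
  then have t_fin: "AE x in M. ?t x \<noteq> \<infinity>"
    by (intro nn_integral_PInf_AE) (auto simp: top_unique)
  obtain D :: "nat \<Rightarrow> 'a set" where D [measurable]: "\<And>n. D n \<in> sets F"
    and Dint: "\<And>n. (\<integral>\<^sup>+x. indicator (D n) x * ?h x \<partial>M) < \<infinity>"
    and Dcov: "\<And>x. x \<in> space M \<Longrightarrow> ?h x < \<infinity> \<Longrightarrow> \<exists>n. x \<in> D n"
    using localization[of ?h, OF borel_measurable_nn_cond_exp] by blast
  note [measurable] = sets_F[OF D]
  \<comment> \<open>\<open>u\<close> itself need not lie in the Orlicz space of the complementary function, but its restriction to \<open>D n\<close> does.\<close>
  have "AE x in M. x \<in> D n \<longrightarrow>
      ?E x \<le> ennreal C * young_inv \<Phi> (?t x) * young_inv (young_conj \<Phi>) (?h x)" for n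
  proof -
    \<comment> \<open>The indicator passes through \<open>young_conj \<Phi>\<close> because that
      function vanishes at 0.\<close>
    have eq: "ennreal (young_conj \<Phi> (cmod (indicator (D n) x * u x)))
        = indicator (D n) x * ennreal (young_conj \<Phi> (cmod (u x)))"
      "ennreal (cmod (f x * (indicator (D n) x * u x))) = indicator (D n) x * ennreal (cmod (u x * f x))" for x
      by (auto split: split_indicator simp: mult.commute)
    have "(\<integral>\<^sup>+x. indicator (D n) x * ennreal (young_conj \<Phi> (cmod (u x))) \<partial>M) < \<infinity>"
      using Dint[of n] nn_cond_exp_intg[of "indicator (D n)" "\<lambda>x. ennreal (young_conj \<Phi> (cmod (u x)))"] by simp
    then have "(\<lambda>x. indicator (D n) x * u x) \<in> orlicz_space M (young_conj \<Phi>)"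
      by (auto simp: orlicz_space_def eq intro!: exI[of _ 1])
    with gch f have "AE x in M.
        nn_cond_exp M F (\<lambda>x. indicator (D n) x * ennreal (cmod (u x * f x))) x
        \<le> ennreal C * young_inv \<Phi> (?t x) * young_inv (young_conj \<Phi>)
          (nn_cond_exp M F (\<lambda>x. indicator (D n) x * ennreal (young_conj \<Phi> (cmod (u x)))) x)"
      unfolding GCH_inequality_def by (force simp: eq)
    moreover have "AE x in M. nn_cond_exp M F (\<lambda>x. indicator (D n) x * ennreal (cmod (u x * f x))) x
        = indicator (D n) x * ?E x"
      by (intro nn_cond_exp_indicator D) measurable
    moreover have "AE x in M. nn_cond_exp M F (\<lambda>x. indicator (D n) x * ennreal (young_conj \<Phi> (cmod (u x)))) x
        = indicator (D n) x * ?h x"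
      by (intro nn_cond_exp_indicator D) measurable
    ultimately show ?thesis
    proof eventually_elim
      case (elim x)
      then show ?case by (cases "x \<in> D n") simp_all
    qed
  qed
  then have "AE x in M. \<forall>n. x \<in> D n \<longrightarrow>
      ?E x \<le> ennreal C * young_inv \<Phi> (?t x) * young_inv (young_conj \<Phi>) (?h x)"
    unfolding AE_all_countable by blast
  moreover have "AE x in M. ?E x < \<infinity> \<longrightarrow> ennreal (cmod (cond_exp_mult M F u f x)) \<le> ?E x"
    unfolding cond_exp_mult_def by (rule cmod_complex_cond_exp_le) measurable
  moreover have "AE x in M. ?E x < \<infinity>"
    using bdd f by (simp add: cond_exp_mult_bounded_def)
  moreover note t_fin B AE_space
  ultimately have "AE x in M. ennreal (\<Phi> (cmod (cond_exp_mult M F u f x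
      - indicator B x * cond_exp_mult M F u f x) / (C * \<epsilon>))) \<le> ?t x"
  proof eventually_elim
    case (elim x)
    show ?case
    proof (cases "x \<in> B")
      case False
      then have small: "young_inv (young_conj \<Phi>) (?h x) < ennreal \<epsilon>" using elim by blast
      \<comment> \<open>The extended inverse is infinite at \<infinity>, so its smallness forces a
        finite argument and places \<open>x\<close> in some \<open>D n\<close>.\<close>
      have "?h x < \<infinity>"
      proof (rule ccontr)
        assume "\<not> ?h x < \<infinity>"
        then have "?h x = \<infinity>" by (simp add: not_less top_unique)
        with small show False by (simp add: young_inv_def)
      qed
      then obtain n where n: "x \<in> D n" using Dcov elim by blast
      have "?t x < \<infinity>" using elim by (simp add: top.not_eq_extremum)
      from young_inv[OF this]
      obtain y where y: "0 \<le> y" "young_inv \<Phi> (?t x) = ennreal y" "ennreal (\<Phi> y) = ?t x"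
        by blast
      have "ennreal (cmod (cond_exp_mult M F u f x)) \<le> ?E x" using elim by blast
      also have "\<dots> \<le> ennreal C * ennreal y * young_inv (young_conj \<Phi>) (?h x)"
        using elim n y by metis
      also have "\<dots> \<le> ennreal C * ennreal y * ennreal \<epsilon>"
        using small by (intro mult_left_mono) auto
      also have "\<dots> = ennreal (C * y * \<epsilon>)" using pos y by (simp add: ennreal_mult)
      finally have "cmod (cond_exp_mult M F u f x) \<le> C * y * \<epsilon>"
        using pos y by (simp add: ennreal_le_iff)
      then have "cmod (cond_exp_mult M F u f x) / (C * \<epsilon>) \<le> y"
        using pos by (simp add: field_simps)
      then have "ennreal (\<Phi> (cmod (cond_exp_mult M F u f x) / (C * \<epsilon>))) \<le> ennreal (\<Phi> y)"
        using pos by (intro ennreal_leI mono) auto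
      with y False show ?thesis by simp
    qed simp
  qed
  then have "(\<integral>\<^sup>+x. ennreal (\<Phi> (cmod (cond_exp_mult M F u f x
      - indicator B x * cond_exp_mult M F u f x) / (C * \<epsilon>))) \<partial>M) \<le> (\<integral>\<^sup>+x. ?t x \<partial>M)"
    by (rule nn_integral_mono_AE)
  also note int_t
  finally show "orlicz_norm M \<Phi> (\<lambda>x. cond_exp_mult M F u f x - indicator B x * cond_exp_mult M F u f x)
      \<le> ennreal (C * \<epsilon>)"
    using pos by (intro orlicz_norm_leI) auto
qed

lemma ess_norm_le:
  fixes u :: "'a \<Rightarrow> complex"
  assumes "young_function (young_conj \<Phi>)" "u \<in> borel_measurable M" "cond_exp_mult_bounded M F \<Phi> u"
    and enum: "atom_enumeration M F N A"
    and gch: "GCH_inequality M F \<Phi> C" and "0 < C"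
  shows "orlicz_ess_norm M \<Phi> (cond_exp_mult M F u) \<le> ennreal C * beta2 M F \<Phi> u"
proof -
  let ?R = "cond_exp_mult M F u"
  let ?W = "\<lambda>\<epsilon>. {w \<in> space M. young_inv (young_conj \<Phi>)
      (nn_cond_exp M F (\<lambda>x. ennreal (young_conj \<Phi> (cmod (u x)))) w) \<ge> ennreal \<epsilon>}"
  have le: "orlicz_ess_norm M \<Phi> ?R \<le> ennreal (C * \<epsilon>)"
    if \<epsilon>: "0 < \<epsilon>" "finitely_many_atoms M F (?W \<epsilon>)" for \<epsilon>
  proof -
    obtain \<B> where \<B>: "finite \<B>" "\<forall>B\<in>\<B>. subalg_atom M F B" "AE x in M. x \<in> ?W \<epsilon> \<longleftrightarrow> x \<in> \<Union>\<B>"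
      using \<epsilon>(2) by (auto simp: finitely_many_atoms_def)
    \<comment> \<open>The atoms in \<open>\<B>\<close> may overlap; replacing them, up to null sets,
      by enumerated atoms supplies the disjointness that the compactness argument uses.\<close>
    have "\<forall>B\<in>\<B>. \<exists>n\<in>N. AE x in M. x \<in> B \<longleftrightarrow> x \<in> A n"
      using \<B>(2) enum by (auto simp: atom_enumeration_def)
    then obtain k where k: "\<And>B. B \<in> \<B> \<Longrightarrow> k B \<in> N" "\<And>B. B \<in> \<B> \<Longrightarrow> AE x in M. x \<in> B \<longleftrightarrow> x \<in> A (k B)"
      by metis
    let ?B = "\<Union>i\<in>k ` \<B>. A i"
    have "AE x in M. \<forall>B\<in>\<B>. x \<in> B \<longleftrightarrow> x \<in> A (k B)"
      using k(2) \<B>(1) by (simp add: AE_ball_countable countable_finite)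
    with \<B>(3) AE_space have "AE x in M. x \<notin> ?B \<longrightarrow> young_inv (young_conj \<Phi>)
        (nn_cond_exp M F (\<lambda>x. ennreal (young_conj \<Phi> (cmod (u x)))) x) < ennreal \<epsilon>"
      by eventually_elim (auto simp: not_le)
    then have "orlicz_opnorm M \<Phi> (\<lambda>f x. ?R f x - indicator ?B x * ?R f x) \<le> ennreal (C * \<epsilon>)"
      using assms \<epsilon>(1) by (intro opnorm_off_set_le)
    moreover have "orlicz_compact_op M \<Phi> (\<lambda>f x. indicator ?B x * ?R f x)"
    proof (rule compact_restriction_to_atoms)
      show "orlicz_bounded_linear M \<Phi> ?R" using assms(3) by (simp add: cond_exp_mult_bounded_def)
      show "?R f \<in> borel_measurable F" for f unfolding cond_exp_mult_def by measurable
      show "disjoint_family_on A (k ` \<B>)"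
        using enum k(1) by (auto simp: atom_enumeration_def intro: disjoint_family_on_mono[rotated])
    qed (use \<B> k enum in \<open>auto simp: atom_enumeration_def\<close>)
    ultimately show ?thesis unfolding orlicz_ess_norm_def by (intro INF_lower2) auto
  qed
  have C: "ennreal C * (ennreal (1 / C) * x) = x" "ennreal (1 / C) * (ennreal C * x) = x" for x
    using \<open>0 < C\<close> by (simp_all add: mult.assoc[symmetric] flip: ennreal_mult)
  \<comment> \<open>The constant is moved to the left so that the bounds for single
    \<open>\<epsilon>\<close> can be compared with the infimum directly.\<close>
  have "ennreal (1 / C) * orlicz_ess_norm M \<Phi> ?R \<le> beta2 M F \<Phi> u"
    unfolding beta2_def
  proof (rule INF_greatest, clarify)
    fix \<epsilon> :: real assume "0 < \<epsilon>" "finitely_many_atoms M F (?W \<epsilon>)"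
    from le[OF this] have "ennreal (1 / C) * orlicz_ess_norm M \<Phi> ?R \<le> ennreal (1 / C) * (ennreal C * ennreal \<epsilon>)"
      using \<open>0 < C\<close> \<open>0 < \<epsilon>\<close> by (intro mult_left_mono) (auto simp: ennreal_mult)
    then show "ennreal (1 / C) * orlicz_ess_norm M \<Phi> ?R \<le> ennreal \<epsilon>" by (simp only: C)
  qed
  then have "ennreal C * (ennreal (1 / C) * orlicz_ess_norm M \<Phi> ?R) \<le> ennreal C * beta2 M F \<Phi> u"
    by (rule mult_left_mono) simp
  then show ?thesis by (simp only: C)
qed

section \<open>The lower bound for the essential norm\<close>

lemma opnorm_diff_compact_ge:
  fixes u :: "'a \<Rightarrow> complex"
  assumes u [measurable]: "u \<in> borel_measurable M" and lin: "orlicz_linear M \<Phi> (cond_exp_mult M F u)"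
    and S: "orlicz_compact_op M \<Phi> S" and "0 < \<epsilon>"
    and inf: "\<not> finitely_many_atoms M F {w \<in> space M. cmod (complex_cond_exp M F u w) \<ge> \<epsilon>}"
  shows "ennreal \<epsilon> \<le> orlicz_opnorm M \<Phi> (\<lambda>f x. cond_exp_mult M F u f x - S f x)"
proof (rule ccontr)
  let ?R = "cond_exp_mult M F u" and ?N = "orlicz_norm M \<Phi>" and ?e = "complex_cond_exp M F u"
  let ?T = "\<lambda>f x. ?R f x - S f x" and ?G = "{w \<in> space M. cmod (?e w) \<ge> \<epsilon>}"
  assume "\<not> ennreal \<epsilon> \<le> orlicz_opnorm M \<Phi> ?T"
  then obtain l where l: "orlicz_opnorm M \<Phi> ?T = ennreal l" "0 \<le> l" "l < \<epsilon>"
    by (cases "orlicz_opnorm M \<Phi> ?T") (auto simp: not_le ennreal_less_iff)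
  have linS: "orlicz_linear M \<Phi> S" using S by (simp add: orlicz_compact_op_def)
  have linT: "orlicz_linear M \<Phi> ?T" using lin linS by (rule orlicz_linear_diff)
  have "?G = {w \<in> space F. cmod (?e w) \<ge> \<epsilon>}" by (simp add: space_F)
  also have "\<dots> \<in> sets F" by measurable
  finally obtain B :: "nat \<Rightarrow> 'a set" where B: "disjoint_family B" "\<And>n. B n \<in> sets F" "\<And>n. B n \<subseteq> ?G"
    "\<And>n. 0 < emeasure M (B n)" "\<And>n. emeasure M (B n) < \<infinity>"
    using not_finitely_many_atoms_disjoint_family[OF _ inf] by blast
  have "\<exists>\<rho>>0. ?N (indicator (B n)) = ennreal \<rho>" for n
    by (rule orlicz_norm_indicator[OF sets_F[OF B(2)] B(4,5)])
  then obtain \<rho> where \<rho>: "\<And>n. 0 < \<rho> n" "\<And>n. ?N (indicator (B n)) = ennreal (\<rho> n)" by metis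
  define f where "f n x = complex_of_real (1 / \<rho> n) * indicator (B n) x" for n x
  have ind: "indicator (B n) \<in> orlicz_space M \<Phi>" for n
    using B by (intro orlicz_space_indicator sets_F)
  have f: "f n \<in> orlicz_space M \<Phi>" for n
    unfolding f_def by (intro orlicz_space_cmult ind)
  have Nf: "?N (f n) = 1" for n
  proof -
    have "?N (f n) = ennreal (1 / \<rho> n) * ennreal (\<rho> n)"
      unfolding f_def using \<rho>[of n] by (subst orlicz_norm_cmult) (simp add: norm_divide)
    also have "\<dots> = 1" using \<rho>(1)[of n] by (simp flip: ennreal_mult)
    finally show ?thesis .
  qed
  \<comment> \<open>On functions supported by a set of the subalgebra and constant there, the
    operator is multiplication by the conditional expectation of \<open>u\<close>.\<close>
  have Rf: "AE x in M. ?R (f n) x = ?e x * f n x" for n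
  proof -
    have "AE x in M. ?R (indicator (B n)) x = indicator (B n) x * ?e x"
      using complex_cond_exp_indicator[OF B(2) u, of n] by (simp add: cond_exp_mult_def mult.commute)
    moreover have "AE x in M. ?R (f n) x = complex_of_real (1 / \<rho> n) * ?R (indicator (B n)) x"
      unfolding f_def by (rule orlicz_linearD[OF lin ind])
    ultimately show ?thesis by eventually_elim (simp add: f_def)
  qed
  have "\<forall>n. f n \<in> orlicz_space M \<Phi> \<and> ?N (f n) \<le> 1" using f Nf by simp
  with S obtain r g where r: "strict_mono (r :: nat \<Rightarrow> nat)" and g: "g \<in> orlicz_space M \<Phi>"
    and lim: "(\<lambda>n. ?N (\<lambda>x. S (f (r n)) x - g x)) \<longlonglongrightarrow> 0"
    unfolding orlicz_compact_op_def by blast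
  \<comment> \<open>The two errors from compactness then add up to
    \<open>(\<epsilon> - l) / 2\<close>, strictly below the gap \<open>(\<epsilon> - l) * t\<close>
    since \<open>t \<ge> 1\<close>.\<close>
  define \<delta> where "\<delta> = (\<epsilon> - l) / 4"
  have "0 < \<delta>" using l by (simp add: \<delta>_def)
  then obtain n where n: "\<And>m. n \<le> m \<Longrightarrow> ?N (\<lambda>x. S (f (r m)) x - g x) < ennreal \<delta>"
    using order_tendstoD(2)[OF lim, of "ennreal \<delta>"] by (auto simp: eventually_sequentially)
  define i j where "i = r n" and "j = r (Suc n)"
  have "i \<noteq> j" using r by (auto simp: i_def j_def strict_mono_eq)
  then have disj: "B i \<inter> B j = {}" using B(1) by (auto simp: disjoint_family_on_def)
  define h where "h x = f i x + (- 1) * f j x" for x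
  have fj: "(\<lambda>x. (- 1) * f j x) \<in> orlicz_space M \<Phi>" using f by (rule orlicz_space_cmult)
  have h: "h \<in> orlicz_space M \<Phi>" unfolding h_def by (rule orlicz_space_add[OF f fj])
  have comb: "AE x in M. T h x = T (f i) x - T (f j) x" if "orlicz_linear M \<Phi> T" for T
    using orlicz_linearD(3)[OF that f fj, of i] orlicz_linearD(4)[OF that f, of "- 1" j]
    unfolding h_def by eventually_elim simp
  note [measurable] = orlicz_space_measurable[OF g] orlicz_space_measurable[OF f]
    orlicz_space_measurable[OF h] orlicz_space_measurable[OF orlicz_linearD(1)[OF linS f]]
    orlicz_space_measurable[OF orlicz_linearD(1)[OF linS h]]
    orlicz_space_measurable[OF orlicz_linearD(1)[OF lin h]]
  \<comment> \<open>Disjoint supports rule out cancellation, so \<open>h\<close> dominates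
    \<open>f i\<close> in modulus.\<close>
  have "1 \<le> ?N h"
    unfolding Nf[of i, symmetric] using disj
    by (intro orlicz_norm_mono AE_I2) (auto simp: h_def f_def split: split_indicator)
  \<comment> \<open>The upper bound serves to make the norm finite, hence a real number
    \<open>t\<close>.\<close>
  moreover have "?N h \<le> 1 + 1"
    unfolding h_def using orlicz_norm_triangle[of "f i" M "\<lambda>x. (- 1) * f j x"] by (simp add: orlicz_norm_uminus Nf)
  ultimately obtain t where t: "?N h = ennreal t" "1 \<le> t"
    by (cases "?N h") (auto simp: top_unique)
  have "ennreal \<epsilon> * ennreal t = ?N (\<lambda>x. complex_of_real \<epsilon> * h x)"
    using t \<open>0 < \<epsilon>\<close> by (simp add: orlicz_norm_cmult)
  also have "\<dots> \<le> ?N (?R h)"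
  proof (rule orlicz_norm_mono)
    show "AE x in M. cmod (complex_of_real \<epsilon> * h x) \<le> cmod (?R h x)"
      using comb[OF lin] Rf[of i] Rf[of j]
    proof eventually_elim
      case (elim x)
      then have "?R h x = ?e x * h x" by (simp add: h_def algebra_simps)
      \<comment> \<open>The support of \<open>h\<close> lies in \<open>B i\<close> and
        \<open>B j\<close>, both contained in the superlevel set.\<close>
      moreover have "h x = 0 \<or> \<epsilon> \<le> cmod (?e x)"
        using B(3)[of i] B(3)[of j] by (auto simp: h_def f_def split: split_indicator)
      ultimately show ?case using \<open>0 < \<epsilon>\<close> by (auto simp: norm_mult intro: mult_right_mono)
    qed
  qed
  also have "?N (?R h) = ?N (\<lambda>x. ?T h x + S h x)" by simp
  also have "\<dots> \<le> ?N (?T h) + ?N (S h)" by (rule orlicz_norm_triangle) measurable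
  also have "?N (?T h) \<le> ennreal l * ennreal t"
    using orlicz_norm_le_opnorm[OF linT h t(1)] t l by simp
  \<comment> \<open>Inserting the limit \<open>g\<close> splits the difference into two terms of
    norm below \<open>\<delta>\<close>.\<close>
  also have "?N (S h) = ?N (\<lambda>x. (S (f i) x - g x) + (g x - S (f j) x))"
    using comb[OF linS] by (intro orlicz_norm_cong) (auto elim: eventually_mono)
  also have "\<dots> \<le> ?N (\<lambda>x. S (f i) x - g x) + ?N (\<lambda>x. g x - S (f j) x)"
    by (rule orlicz_norm_triangle) measurable
  also have "\<dots> \<le> ennreal \<delta> + ennreal \<delta>"
    using n[of n] n[of "Suc n"] by (subst (2) orlicz_norm_diff_commute)
      (intro add_mono less_imp_le, auto simp: i_def j_def)
  finally have "ennreal \<epsilon> * ennreal t \<le> ennreal l * ennreal t + (ennreal \<delta> + ennreal \<delta>)"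
    by (simp add: add_mono)
  moreover have "0 \<le> \<epsilon>" "0 \<le> \<delta>" "0 \<le> t" using \<open>0 < \<epsilon>\<close> \<open>0 < \<delta>\<close> t by auto
  ultimately have "ennreal (\<epsilon> * t) \<le> ennreal (l * t + (\<delta> + \<delta>))"
    using l(2) by (simp only: ennreal_mult ennreal_plus add_nonneg_nonneg mult_nonneg_nonneg)
  then have "\<epsilon> * t \<le> l * t + (\<delta> + \<delta>)"
    using \<open>0 < \<delta>\<close> l t by (subst (asm) ennreal_le_iff) auto
  then have "(\<epsilon> - l) * t \<le> (\<epsilon> - l) / 2"
    unfolding left_diff_distrib \<delta>_def by linarith
  moreover have "(\<epsilon> - l) * 1 \<le> (\<epsilon> - l) * t" using l t by (intro mult_left_mono) auto
  ultimately show False using l by simp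
qed

text \<open>A real \<open>\<epsilon>\<close> above the essential norm is beaten by some compact
  \<open>S\<close>; by the preceding bound its superlevel set must be a finite union of atoms, so
  \<open>\<epsilon>\<close> competes in the infimum \<open>beta1\<close>.\<close>

lemma ess_norm_ge:
  fixes u :: "'a \<Rightarrow> complex"
  assumes "u \<in> borel_measurable M" "cond_exp_mult_bounded M F \<Phi> u"
  shows "beta1 M F u \<le> orlicz_ess_norm M \<Phi> (cond_exp_mult M F u)"
proof (rule ennreal_le_real_boundsI)
  fix \<epsilon> :: real assume \<epsilon>: "0 < \<epsilon>" "orlicz_ess_norm M \<Phi> (cond_exp_mult M F u) < ennreal \<epsilon>"
  then obtain S where S: "orlicz_compact_op M \<Phi> S"
    "orlicz_opnorm M \<Phi> (\<lambda>f x. cond_exp_mult M F u f x - S f x) < ennreal \<epsilon>"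
    by (auto simp: orlicz_ess_norm_def INF_less_iff)
  have "orlicz_linear M \<Phi> (cond_exp_mult M F u)"
    using assms(2) by (simp add: cond_exp_mult_bounded_def orlicz_bounded_linear_def)
  then have "finitely_many_atoms M F {w \<in> space M. cmod (complex_cond_exp M F u w) \<ge> \<epsilon>}"
    using opnorm_diff_compact_ge[OF assms(1) _ S(1) \<epsilon>(1)] S(2) by (meson leD)
  then show "beta1 M F u \<le> ennreal \<epsilon>"
    unfolding beta1_def using \<epsilon>(1) by (intro INF_lower) auto
qed

end

theorem theorem3p3:
  fixes M F :: "'a measure" and \<Phi> :: "real \<Rightarrow> real" and u :: "'a \<Rightarrow> complex"
    and N :: "nat set" and A :: "nat \<Rightarrow> 'a set"
  assumes "sigma_finite_measure M"
    and "sigma_finite_subalgebra M F"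
    and "young_function \<Phi>"
    and "young_function (young_conj \<Phi>)"
    and "u \<in> borel_measurable M"
    and "cond_exp_mult_bounded M F \<Phi> u"
    and "atom_enumeration M F N A"
  shows "(\<forall>C>0. GCH_inequality M F \<Phi> C \<longrightarrow>
            orlicz_ess_norm M \<Phi> (cond_exp_mult M F u) \<le> ennreal C * beta2 M F \<Phi> u)
       \<and> (((\<lambda>n. measure M (A n)) \<longlongrightarrow> 0) (inf sequentially (principal N))
            \<or> \<not> (\<exists>r. strict_mono r \<and> range r \<subseteq> N \<and> convergent (\<lambda>k. measure M (A (r k)))) \<longrightarrow>
          orlicz_ess_norm M \<Phi> (cond_exp_mult M F u) \<ge> beta1 M F u)"
proof -
  interpret young_subalgebra \<Phi> M F
    using assms(2,3) by (simp add: young_subalgebra_def young_def)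
  show ?thesis using ess_norm_le ess_norm_ge assms by blast
qed

end
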